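(* Let $G$ be a compact Lie group and let $\Gamma\le G$ be a dense finitely generated subgroup, considered as a discrete group acting on $G$ by left translation. Suppose that the warped cone $\mathcal{O}_\Gamma(G)$ has property A. Then $\Gamma$ is amenable (as a discrete group).
   Context: Open cone: for a compact smooth manifold $Y$, embed $Y$ smoothly in a sphere $S^{N-1}\subset\mathbb{R}^N$; the open cone is $\mathcal{O}Y=\{ty: t\ge 0,\ y\in Y\}\subset\mathbb{R}^N$ with the metric $d$ induced from $\mathbb{R}^N$. Up to coarse equivalence it does not depend on choices. If $\Gamma$ acts on $Y$ by homeomorphisms, it acts on $\mathcal{O}Y$ by $\gamma(ty)=t(\gamma y)$. Warped metric: if $(X,d)$ is a proper metric space (closed bounded sets are compact) on which a group $\Gamma$ with finite generating set $S$ acts by homeomorphisms, then $d_\Gamma$ is the greatest metric on $X$ with $d_\Gamma(x,x')\le d(x,x')$ for all $x,x'\in X$ and $d_\Gamma(x,sx)\le 1$ for all $x\in X$, $s\in S$. The warped cone $\mathcal{O}_\Gamma(Y)$ is $\mathcal{O}Y$ with the metric $d_\Gamma$ (its coarse structure does not depend on choices; it is a proper metric space, of bounded geometry when $\Gamma$ acts on $Y$ by Lipschitz homeomorphisms). Bounded geometry: a metric space $X$ has bounded geometry if there is $\epsilon>0$ such that for every $r>0$ there is $s>0$ such that every $\epsilon$-separated subset of an $r$-ball has at most $s$ elements. Property A: $\mathrm{Prob}(X)$ is the set of Radon probability measures on $X$ (states of $C_0(X)$), with its norm and weak-$*$ topologies. A bounded geometry proper metric space $X$ has property A if there are weak-$*$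 continuous maps $f_n\colon X\to\mathrm{Prob}(X)$ ($n=1,2,\dots$) such that (i) for each $n$ there is $r$ such that for each $x$ the measure $f_n(x)$ is supported in $B(x;r)$, and (ii) for each $s>0$, $\sup_{d(x,y)<s}\|f_n(x)-f_n(y)\|\to0$ as $n\to\infty$. *)

theory Defs
  imports "HOL-Analysis.Analysis" "HOL-Probability.Probability" "HOL-Algebra.Generated_Groups"
begin

section \<open>Smooth maps, manifolds and Lie groups\<close>

text \<open>For open sets of Euclidean space: \<open>f\<close> is of class \<open>C\<^sup>k\<close>, by iterated directional derivatives.\<close>

primrec Ck_on :: "nat \<Rightarrow> 'a::euclidean_space set \<Rightarrow> ('a \<Rightarrow> 'b::real_normed_vector) \<Rightarrow> bool" where
  "Ck_on 0 U f \<longleftrightarrow> continuous_on U f"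
| "Ck_on (Suc k) U f \<longleftrightarrow>
     (\<forall>x\<in>U. f differentiable (at x)) \<and> (\<forall>v. Ck_on k U (\<lambda>x. frechet_derivative f (at x) v))"

text \<open>For arbitrary subsets \<open>A\<close>: local extendability to \<open>C\<^sup>\<infinity>\<close> functions on open sets. If \<open>A\<close> is a
  relatively open subset of a linear subspace \<open>V\<close>, this is ordinary \<open>C\<^sup>\<infinity>\<close> smoothness on an
  open subset of the vector space \<open>V\<close>.\<close>

definition smooth_on :: "'a::euclidean_space set \<Rightarrow> ('a \<Rightarrow> 'b::real_normed_vector) \<Rightarrow> bool" where
  "smooth_on A f \<longleftrightarrow>
     (\<forall>x\<in>A. \<exists>U g. open U \<and> x \<in> U \<and> (\<forall>k. Ck_on k U g) \<and> (\<forall>y\<in>A \<inter> U. g y = f y))"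

text \<open>A chart is a pair of a domain and a map. The model space is a linear subspace \<open>V\<close> of a
  Euclidean space rather than a whole \<^class>\<open>euclidean_space\<close> type, because such types have
  dimension at least 1 whereas 0-dimensional manifolds (finite groups) must be covered.\<close>

type_synonym ('g, 'e) atlas = "('g set \<times> ('g \<Rightarrow> 'e)) set"

definition smooth_manifold :: "'e::euclidean_space set \<Rightarrow> 'g topology \<Rightarrow> ('g, 'e) atlas \<Rightarrow> bool" where
  "smooth_manifold V T \<A> \<longleftrightarrow>
     subspace V \<and> Hausdorff_space T \<and> second_countable T \<and>
     (\<Union>(U, \<phi>)\<in>\<A>. U) = topspace T \<and>
     (\<forall>(U, \<phi>)\<in>\<A>. openin T U \<and> openin (top_of_set V) (\<phi> ` U) \<and>
        homeomorphic_map (subtopology T U) (top_of_set (\<phi> ` U)) \<phi>) \<and>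
     (\<forall>(U, \<phi>)\<in>\<A>. \<forall>(W, \<psi>)\<in>\<A>. smooth_on (\<phi> ` (U \<inter> W)) (\<psi> \<circ> inv_into U \<phi>))"

definition smooth_map ::
  "'g topology \<Rightarrow> ('g, 'e::euclidean_space) atlas \<Rightarrow> 'h topology \<Rightarrow> ('h, 'f::euclidean_space) atlas
    \<Rightarrow> ('g \<Rightarrow> 'h) \<Rightarrow> bool" where
  "smooth_map T \<A> T' \<B> f \<longleftrightarrow>
     continuous_map T T' f \<and>
     (\<forall>(U, \<phi>)\<in>\<A>. \<forall>(W, \<psi>)\<in>\<B>. smooth_on (\<phi> ` {x\<in>U. f x \<in> W}) (\<psi> \<circ> f \<circ> inv_into U \<phi>))"

definition prod_atlas :: "('g, 'e) atlas \<Rightarrow> ('h, 'f) atlas \<Rightarrow> ('g \<times> 'h, 'e \<times> 'f) atlas" where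
  "prod_atlas \<A> \<B> = {(U \<times> W, map_prod \<phi> \<psi>) | U \<phi> W \<psi>. (U, \<phi>) \<in> \<A> \<and> (W, \<psi>) \<in> \<B>}"

definition Lie_group ::
  "'e::euclidean_space set \<Rightarrow> ('g, 'm) monoid_scheme \<Rightarrow> 'g topology \<Rightarrow> ('g, 'e) atlas \<Rightarrow> bool" where
  "Lie_group V G T \<A> \<longleftrightarrow>
     group G \<and> topspace T = carrier G \<and> smooth_manifold V T \<A> \<and>
     smooth_map (prod_topology T T) (prod_atlas \<A> \<A>) T \<A> (\<lambda>(x, y). x \<otimes>\<^bsub>G\<^esub> y) \<and>
     smooth_map T \<A> T \<A> (\<lambda>x. inv\<^bsub>G\<^esub> x)"

definition smooth_embedding ::
  "'e::euclidean_space set \<Rightarrow> 'g topology \<Rightarrow> ('g, 'e) atlas \<Rightarrow> ('g \<Rightarrow> 'a::euclidean_space) \<Rightarrow> bool" where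
  "smooth_embedding V T \<A> \<iota> \<longleftrightarrow>
     smooth_map T \<A> euclidean {(UNIV, \<lambda>z. z)} \<iota> \<and>
     embedding_map T euclidean \<iota> \<and>
     (\<forall>(U, \<phi>)\<in>\<A>. \<forall>x\<in>U. \<exists>D.
        ((\<iota> \<circ> inv_into U \<phi>) has_derivative D) (at (\<phi> x) within \<phi> ` U) \<and> inj_on D V)"

section \<open>Warped cones\<close>

definition open_cone :: "'a::real_vector set \<Rightarrow> 'a set" where
  "open_cone Y = {t *\<^sub>R y | t y. 0 \<le> t \<and> y \<in> Y}"

text \<open>Extension to the cone over \<open>\<iota> ` Y\<close>, with \<open>\<iota> ` Y\<close> in the unit sphere, of an action \<open>act\<close> on
  \<open>Y\<close>; see \<open>cone_action_eq\<close> for the defining property.\<close>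

definition cone_action ::
  "'g set \<Rightarrow> ('g \<Rightarrow> 'a::real_normed_vector) \<Rightarrow> ('s \<Rightarrow> 'g \<Rightarrow> 'g) \<Rightarrow> 's \<Rightarrow> 'a \<Rightarrow> 'a" where
  "cone_action Y \<iota> act \<gamma> z = norm z *\<^sub>R \<iota> (act \<gamma> (inv_into Y \<iota> (z /\<^sub>R norm z)))"

lemma cone_action_eq:
  assumes "inj_on \<iota> Y" "\<iota> ` Y \<subseteq> sphere 0 1" "0 \<le> t" "y \<in> Y"
  shows "cone_action Y \<iota> act \<gamma> (t *\<^sub>R \<iota> y) = t *\<^sub>R \<iota> (act \<gamma> y)"
proof (cases "t = 0")
  case False
  have "norm (\<iota> y) = 1" using assms by auto
  then show ?thesis using False assms by (simp add: cone_action_def)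
qed (simp add: cone_action_def)

definition warped_candidates ::
  "'a metric \<Rightarrow> ('s \<Rightarrow> 'a \<Rightarrow> 'a) \<Rightarrow> 's set \<Rightarrow> 'a metric set" where
  "warped_candidates m act S =
     {w. mspace w = mspace m \<and>
         (\<forall>x\<in>mspace m. \<forall>y\<in>mspace m. mdist w x y \<le> mdist m x y) \<and>
         (\<forall>x\<in>mspace m. \<forall>s\<in>S. mdist w x (act s x) \<le> 1)}"

definition is_warped_metric ::
  "'a metric \<Rightarrow> ('s \<Rightarrow> 'a \<Rightarrow> 'a) \<Rightarrow> 's set \<Rightarrow> 'a metric \<Rightarrow> bool" where
  "is_warped_metric m act S w \<longleftrightarrow>
     w \<in> warped_candidates m act S \<and>
     (\<forall>w'\<in>warped_candidates m act S. \<forall>x\<in>mspace m. \<forall>y\<in>mspace m. mdist w' x y \<le> mdist w x y)"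

text \<open>The greatest metric exists. (It is unique on \<open>mspace m\<close>, and \<^const>\<open>mdist\<close> is
  irrelevant elsewhere.)\<close>

lemma warped_metric_exists:
  assumes act: "\<And>s x. s \<in> S \<Longrightarrow> x \<in> mspace m \<Longrightarrow> act s x \<in> mspace m"
  shows "\<exists>w. is_warped_metric m act S w"
proof -
  let ?X = "mspace m" and ?C = "warped_candidates m act S"
  define d0 where "d0 = (\<lambda>x y. min (mdist m x y) 1)"
  interpret d0: Metric_space ?X d0
  proof
    fix x y z assume "x \<in> ?X" "y \<in> ?X" "z \<in> ?X"
    then show "d0 x z \<le> d0 x y + d0 y z"
      using mdist_triangle[of x m y z] mdist_nonneg[of m x y] mdist_nonneg[of m y z]
      unfolding d0_def by linarith
    have "mdist m x y = 0 \<longleftrightarrow> x = y" using \<open>x \<in> ?X\<close> \<open>y \<in> ?X\<close> by simp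
    then show "d0 x y = 0 \<longleftrightarrow> x = y" unfolding d0_def by linarith
  qed (auto simp: d0_def mdist_commute)
  have c0: "metric (?X, d0) \<in> ?C"
    using act unfolding warped_candidates_def by (simp, simp add: d0_def)
  define D where "D = (\<lambda>x y. if x \<in> ?X \<and> y \<in> ?X then (SUP w\<in>?C. mdist w x y) else 0)"
  have bdd: "bdd_above ((\<lambda>w. mdist w x y) ` ?C)" if "x \<in> ?X" "y \<in> ?X" for x y
    using that by (auto simp: warped_candidates_def intro!: bdd_aboveI[of _ "mdist m x y"])
  have up: "mdist w x y \<le> D x y" if "w \<in> ?C" "x \<in> ?X" "y \<in> ?X" for w x y
    using cSUP_upper[OF that(1) bdd[OF that(2,3)]] that by (simp add: D_def)
  have le: "D x y \<le> c" if "x \<in> ?X" "y \<in> ?X" "\<And>w. w \<in> ?C \<Longrightarrow> mdist w x y \<le> c" for x y c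
    using cSUP_least[of ?C "\<lambda>w. mdist w x y" c] c0 that by (auto simp: D_def)
  have pos: "0 \<le> D x y" for x y
  proof (cases "x \<in> ?X \<and> y \<in> ?X")
    case True
    then have "d0 x y \<le> D x y" using up[OF c0, of x y] by simp
    then show ?thesis using d0.nonneg[of x y] by linarith
  qed (auto simp: D_def)
  interpret D: Metric_space ?X D
  proof
    show "D x y = D y x" for x y by (simp add: D_def mdist_commute)
    fix x y assume xy: "x \<in> ?X" "y \<in> ?X"
    have "D x x \<le> 0"
    proof (rule le[OF xy(1) xy(1)])
      fix w assume "w \<in> ?C"
      then have "x \<in> mspace w" using xy by (simp add: warped_candidates_def)
      then show "mdist w x x \<le> 0" by (metis mdist_zero order_refl)
    qed
    moreover have "d0 x y \<le> D x y" using up[OF c0 xy] by simp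
    ultimately show "D x y = 0 \<longleftrightarrow> x = y"
      using pos[of x x] d0.zero[OF xy] d0.nonneg[of x y] by (metis order_antisym)
    fix z assume z: "z \<in> ?X"
    show "D x z \<le> D x y + D y z"
    proof (rule le[OF xy(1) z])
      fix w assume w: "w \<in> ?C"
      then have "mspace w = ?X" by (simp add: warped_candidates_def)
      then have "mdist w x z \<le> mdist w x y + mdist w y z" using mdist_triangle xy z by metis
      then show "mdist w x z \<le> D x y + D y z" using up[OF w] xy z by (meson add_mono order_trans)
    qed
  qed (rule pos)
  have "metric (?X, D) \<in> ?C"
  proof -
    have "D x y \<le> mdist m x y" if "x \<in> ?X" "y \<in> ?X" for x y
      using that by (intro le) (auto simp: warped_candidates_def)
    moreover have "D x (act s x) \<le> 1" if "x \<in> ?X" "s \<in> S" for x s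
      using that act by (intro le) (auto simp: warped_candidates_def)
    ultimately show ?thesis by (auto simp: warped_candidates_def)
  qed
  then have "is_warped_metric m act S (metric (?X, D))"
    using up by (auto simp: is_warped_metric_def)
  then show ?thesis by blast
qed

section \<open>Property A\<close>

definition C0 :: "'a topology \<Rightarrow> ('a \<Rightarrow> real) set" where
  "C0 T = {\<phi>. continuous_map T euclideanreal \<phi> \<and>
              (\<forall>\<epsilon>>0. \<exists>K. compactin T K \<and> (\<forall>x\<in>topspace T - K. \<bar>\<phi> x\<bar> < \<epsilon>))}"

definition Prob :: "'a topology \<Rightarrow> 'a measure set" where
  "Prob T = {\<mu>. space \<mu> = topspace T \<and> sets \<mu> = sigma_sets (topspace T) {U. openin T U} \<and>
                prob_space \<mu> \<and>
                (\<forall>B\<in>sets \<mu>. emeasure \<mu> B = (SUP K\<in>{K. compactin T K \<and> K \<subseteq> B}. emeasure \<mu> K))}"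

definition weak_star_topology :: "'a topology \<Rightarrow> 'a measure topology" where
  "weak_star_topology T =
     topology_generated_by {{\<mu>\<in>Prob T. (\<integral>x. \<phi> x \<partial>\<mu>) \<in> U} | \<phi> U. \<phi> \<in> C0 T \<and> open U}"

text \<open>The distance induced by the norm of the dual of \<open>C\<^sub>0(X)\<close>. Using real-valued test functions
  gives the same norm on real functionals as using complex-valued ones.\<close>

definition norm_dist :: "'a topology \<Rightarrow> 'a measure \<Rightarrow> 'a measure \<Rightarrow> real" where
  "norm_dist T \<mu> \<nu> =
     (SUP \<phi>\<in>{\<phi>\<in>C0 T. \<forall>x\<in>topspace T. \<bar>\<phi> x\<bar> \<le> 1}. \<bar>(\<integral>x. \<phi> x \<partial>\<mu>) - (\<integral>x. \<phi> x \<partial>\<nu>)\<bar>)"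

text \<open>Intended for proper metric spaces of bounded geometry; the warped cones considered here are
  always of this kind.\<close>

definition property_A :: "'a metric \<Rightarrow> bool" where
  "property_A m \<longleftrightarrow>
     (\<exists>f :: nat \<Rightarrow> 'a \<Rightarrow> 'a measure.
        (\<forall>n. continuous_map (mtopology_of m) (weak_star_topology (mtopology_of m)) (f n)) \<and>
        (\<forall>n. \<exists>r. \<forall>x\<in>mspace m. emeasure (f n x) (mspace m - mball_of m x r) = 0) \<and>
        (\<forall>s>0. (\<lambda>n. SUP (x, y)\<in>{(x, y). x \<in> mspace m \<and> y \<in> mspace m \<and> mdist m x y < s}.
                       norm_dist (mtopology_of m) (f n x) (f n y)) \<longlonglongrightarrow> 0))"

section \<open>Amenability\<close>

text \<open>Amenability of a discrete group, by a finitely additive left-invariant probability measure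
  defined on all subsets.\<close>

definition amenable_group :: "('g, 'm) monoid_scheme \<Rightarrow> bool" where
  "amenable_group H \<longleftrightarrow>
     (\<exists>\<mu> :: 'g set \<Rightarrow> real.
        \<mu> (carrier H) = 1 \<and>
        (\<forall>A\<subseteq>carrier H. 0 \<le> \<mu> A) \<and>
        (\<forall>A\<subseteq>carrier H. \<forall>B\<subseteq>carrier H. A \<inter> B = {} \<longrightarrow> \<mu> (A \<union> B) = \<mu> A + \<mu> B) \<and>
        (\<forall>h\<in>carrier H. \<forall>A\<subseteq>carrier H. \<mu> (h <#\<^bsub>H\<^esub> A) = \<mu> A))"

end

theory Submission
  imports Defs
begin

text \<open>
  Property A gives, for a suitable \<open>n\<close>, a map \<open>F = f\<^sub>n\<close> into probability measures that varies by at most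
  \<open>\<epsilon>\<close> along the generators and has supports in warped \<open>R\<close>-balls. Far out on the cone, the warped \<open>R\<close>-ball
  around \<open>t \<iota>(g)\<close> is concentrated near the points \<open>s \<iota>(\<gamma>\<inverse> g)\<close> with \<open>\<gamma>\<close> in a finite subset \<open>B\<close> of \<open>\<Gamma>\<close>, and
  these are uniformly separated because left translation is free. Integrating disjoint bump functions
  against \<open>F (t \<iota>(g))\<close> thus gives \<open>p \<gamma> g \<ge> 0\<close>, of sum 1 over \<open>\<gamma> \<in> B\<close>, continuous in \<open>g\<close>, with
  \<open>p (s \<gamma>) (s g)\<close> close to \<open>p \<gamma> g\<close>. Averaging over \<open>g\<close> yields almost invariant probabilities on \<open>\<Gamma>\<close>, and
  compactness an invariant mean. No Haar measure is needed: finitely many continuous functions become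
  simultaneously almost constant under a finite average of right translates, and such an average commutes
  with left translations.
\<close>

section \<open>Almost invariant means\<close>

text \<open>By Tychonoff the \<open>[0,1]\<close>-valued set functions form a compact space. For
  each \<epsilon> the approximate conditions are closed, as each involves finitely many coordinates,
  and the smallest of finitely many tolerances serves them all. A common point is exactly invariant
  under \<open>S\<close>, hence under the group it generates.\<close>

lemma amenable_group_approx:
  fixes G :: "('g, 'm) monoid_scheme"
  assumes sg: "subgroup \<Gamma> G" and G: "group G" and S: "S \<subseteq> \<Gamma>" "generate G S = \<Gamma>"
    and approx: "\<And>\<epsilon>. 0 < \<epsilon> \<Longrightarrow> \<exists>\<mu> :: 'g set \<Rightarrow> real. \<mu> \<Gamma> = 1 \<and> (\<forall>A\<subseteq>\<Gamma>. 0 \<le> \<mu> A) \<and>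
        (\<forall>A\<subseteq>\<Gamma>. \<forall>B\<subseteq>\<Gamma>. A \<inter> B = {} \<longrightarrow> \<mu> (A \<union> B) = \<mu> A + \<mu> B) \<and>
        (\<forall>s\<in>S. \<forall>A\<subseteq>\<Gamma>. \<bar>\<mu> (s <#\<^bsub>G\<^esub> A) - \<mu> A\<bar> \<le> \<epsilon>)"
  shows "amenable_group (G\<lparr>carrier := \<Gamma>\<rparr>)"
proof -
  interpret group G by fact
  interpret \<Gamma>: subgroup \<Gamma> G by fact
  have cosub: "h <#\<^bsub>G\<^esub> A \<subseteq> \<Gamma>" if "h \<in> \<Gamma>" "A \<subseteq> \<Gamma>" for h A
    using that by (auto simp: l_coset_def)
  define K where "K = PiE UNIV (\<lambda>_ :: 'g set. {0..1::real})"
  have K: "compact K"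
    unfolding K_def using compactin_PiE[of "\<lambda>_. euclideanreal" UNIV "\<lambda>_. {0..1}"]
    by (simp add: euclidean_product_topology)
  define C where "C = (\<lambda>\<epsilon>. {\<mu> :: 'g set \<Rightarrow> real. \<mu> \<Gamma> = 1 \<and> (\<forall>A\<in>Pow \<Gamma>. 0 \<le> \<mu> A) \<and>
        (\<forall>A\<in>Pow \<Gamma>. \<forall>B\<in>{B\<in>Pow \<Gamma>. A \<inter> B = {}}. \<mu> (A \<union> B) = \<mu> A + \<mu> B) \<and>
        (\<forall>s\<in>S. \<forall>A\<in>Pow \<Gamma>. \<bar>\<mu> (s <#\<^bsub>G\<^esub> A) - \<mu> A\<bar> \<le> \<epsilon>)})"
  have cl: "closed (C \<epsilon>)" for \<epsilon>
    unfolding C_def Ball_def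
    by (intro closed_Collect_conj closed_Collect_all closed_Collect_imp closed_Collect_eq
        closed_Collect_le continuous_intros continuous_on_product_coordinates open_Collect_const)
  have ne: "K \<inter> \<Inter> (C ` E) \<noteq> {}" if E: "finite E" "E \<subseteq> {0<..}" for E
  proof -
    \<comment> \<open>The 1 keeps the minimum defined when \<open>E\<close> is empty.\<close>
    define \<epsilon> where "\<epsilon> = Min (insert 1 E)"
    have \<epsilon>: "0 < \<epsilon>" "\<And>e. e \<in> E \<Longrightarrow> \<epsilon> \<le> e" using E by (auto simp: \<epsilon>_def)
    obtain \<mu> :: "'g set \<Rightarrow> real" where \<mu>: "\<mu> \<Gamma> = 1" "\<forall>A\<subseteq>\<Gamma>. 0 \<le> \<mu> A"
        "\<forall>A\<subseteq>\<Gamma>. \<forall>B\<subseteq>\<Gamma>. A \<inter> B = {} \<longrightarrow> \<mu> (A \<union> B) = \<mu> A + \<mu> B"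
        "\<forall>s\<in>S. \<forall>A\<subseteq>\<Gamma>. \<bar>\<mu> (s <#\<^bsub>G\<^esub> A) - \<mu> A\<bar> \<le> \<epsilon>"
      using approx[OF \<epsilon>(1)] by (elim exE conjE) (rule that)
    have le1: "\<mu> A \<le> 1" if "A \<subseteq> \<Gamma>" for A
    proof -
      have "\<mu> (A \<union> (\<Gamma> - A)) = \<mu> A + \<mu> (\<Gamma> - A)" using \<mu>(3)[rule_format, of A "\<Gamma> - A"] that by auto
      moreover have "0 \<le> \<mu> (\<Gamma> - A)" using \<mu>(2)[rule_format, of "\<Gamma> - A"] by auto
      moreover have "A \<union> (\<Gamma> - A) = \<Gamma>" using that by blast
      ultimately show ?thesis using \<mu>(1) by simp
    qed
    \<comment> \<open>Membership in \<open>K\<close> constrains the value at every set of the type,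
      so values off the subsets of \<Gamma> are reset to 0.\<close>
    define \<nu> where "\<nu> = (\<lambda>A. if A \<subseteq> \<Gamma> then \<mu> A else 0)"
    have "\<nu> \<in> K" using le1 \<mu>(2) by (auto simp: \<nu>_def K_def)
    moreover have "\<nu> \<in> C e" if "e \<in> E" for e
    proof -
      have "\<bar>\<nu> (s <#\<^bsub>G\<^esub> A) - \<nu> A\<bar> \<le> e" if "s \<in> S" "A \<subseteq> \<Gamma>" for s A
      proof -
        have "\<nu> (s <#\<^bsub>G\<^esub> A) = \<mu> (s <#\<^bsub>G\<^esub> A)" "\<nu> A = \<mu> A"
          using cosub[of s A] S(1) that by (auto simp: \<nu>_def)
        moreover have "\<bar>\<mu> (s <#\<^bsub>G\<^esub> A) - \<mu> A\<bar> \<le> \<epsilon>" using \<mu>(4) that by blast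
        ultimately show ?thesis using \<epsilon>(2)[OF \<open>e \<in> E\<close>] by linarith
      qed
      then show ?thesis using \<mu> by (auto simp: C_def \<nu>_def)
    qed
    ultimately show ?thesis by blast
  qed
  have "K \<inter> \<Inter> (C ` {0<..}) \<noteq> {}"
  proof (rule compact_imp_fip[OF K])
    show "closed T" if "T \<in> C ` {0<..}" for T using that cl by auto
    fix F assume "finite F" "F \<subseteq> C ` {0<..}"
    then obtain E where "E \<subseteq> {0<..}" "finite E" "F = C ` E" by (meson finite_subset_image)
    then show "K \<inter> \<Inter> F \<noteq> {}" using ne by blast
  qed
  then obtain \<mu> where \<mu>C: "\<And>e. 0 < e \<Longrightarrow> \<mu> \<in> C e" by auto
  have inv: "\<mu> (s <#\<^bsub>G\<^esub> A) = \<mu> A" if "s \<in> S" "A \<subseteq> \<Gamma>" for s A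
  proof -
    have "\<bar>\<mu> (s <#\<^bsub>G\<^esub> A) - \<mu> A\<bar> \<le> 0 + e" if "0 < e" for e
      using \<mu>C[OF that] \<open>s \<in> S\<close> \<open>A \<subseteq> \<Gamma>\<close> by (auto simp: C_def)
    then have "\<bar>\<mu> (s <#\<^bsub>G\<^esub> A) - \<mu> A\<bar> \<le> 0" by (rule field_le_epsilon)
    then show ?thesis by simp
  qed
  have \<Gamma>c: "\<Gamma> \<subseteq> carrier G" by (rule \<Gamma>.subset)
  have all: "\<mu> (h <#\<^bsub>G\<^esub> A) = \<mu> A" if "h \<in> generate G S" "A \<subseteq> \<Gamma>" for h A
    using that
  proof (induction arbitrary: A)
    case one
    then show ?case using lcos_mult_one \<Gamma>c by (metis order_trans)
  next
    case (incl h)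
    then show ?case using inv by blast
  next
    case (inv h)
    have h: "h \<in> \<Gamma>" using inv.hyps S(1) by auto
    then have h': "inv\<^bsub>G\<^esub> h \<in> \<Gamma>" by (rule \<Gamma>.m_inv_closed)
    \<comment> \<open>Invariance is known for \<open>h\<close> only, so it is applied to the
      translate of \<open>A\<close> by the inverse of \<open>h\<close>.\<close>
    have "h <#\<^bsub>G\<^esub> (inv\<^bsub>G\<^esub> h <#\<^bsub>G\<^esub> A) = A"
      using h h' \<Gamma>c inv.prems lcos_m_assoc[of A h "inv\<^bsub>G\<^esub> h"] lcos_mult_one[of A] by (auto simp: subset_iff)
    then show ?case using \<open>\<And>s A. \<lbrakk>s \<in> S; A \<subseteq> \<Gamma>\<rbrakk> \<Longrightarrow> \<mu> (s <#\<^bsub>G\<^esub> A) = \<mu> A\<close>[OF inv.hyps cosub[OF h' inv.prems]]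
      by simp
  next
    case (eng h1 h2)
    have h: "h1 \<in> \<Gamma>" "h2 \<in> \<Gamma>" using eng S by auto
    have "(h1 \<otimes>\<^bsub>G\<^esub> h2) <#\<^bsub>G\<^esub> A = h1 <#\<^bsub>G\<^esub> (h2 <#\<^bsub>G\<^esub> A)"
      using lcos_m_assoc[of A h1 h2] h \<Gamma>c eng.prems by (auto simp: subset_iff)
    then show ?case using eng.IH eng.prems cosub[OF h(2) eng.prems] by simp
  qed
  have lc: "h <#\<^bsub>G\<lparr>carrier := \<Gamma>\<rparr>\<^esub> A = h <#\<^bsub>G\<^esub> A" for h A by (simp add: l_coset_def)
  have "\<mu> \<in> C 1" using \<mu>C by simp
  then show ?thesis unfolding amenable_group_def lc
    using all S by (intro exI[of _ \<mu>]) (auto simp: C_def)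
qed

section \<open>Right averages on a group\<close>

text \<open>Abstracts finite averages of right translates. The properties listed are stable under
  composition, so averages can be iterated; the last one says that they commute with left
  translations.\<close>

definition right_mean :: "('g, 'm) monoid_scheme \<Rightarrow> (('g \<Rightarrow> real) \<Rightarrow> 'g \<Rightarrow> real) \<Rightarrow> bool" where
  "right_mean G M \<longleftrightarrow>
     (\<forall>f g y. M (\<lambda>x. f x + g x) y = M f y + M g y) \<and>
     (\<forall>f g y. (\<forall>x\<in>carrier G. f x \<le> g x) \<longrightarrow> y \<in> carrier G \<longrightarrow> M f y \<le> M g y) \<and>
     (\<forall>c y. M (\<lambda>_. c) y = c) \<and>
     (\<forall>f s y. s \<in> carrier G \<longrightarrow> y \<in> carrier G \<longrightarrow> M (\<lambda>x. f (s \<otimes>\<^bsub>G\<^esub> x)) y = M f (s \<otimes>\<^bsub>G\<^esub> y))"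

lemma
  assumes "right_mean G M"
  shows right_mean_add: "M (\<lambda>x. f x + g x) y = M f y + M g y"
    and right_mean_mono:
      "\<lbrakk>\<And>x. x \<in> carrier G \<Longrightarrow> f x \<le> g x; y \<in> carrier G\<rbrakk> \<Longrightarrow> M f y \<le> M g y"
    and right_mean_const: "M (\<lambda>_. c) y = c"
    and right_mean_left_translate:
      "\<lbrakk>s \<in> carrier G; y \<in> carrier G\<rbrakk> \<Longrightarrow> M (\<lambda>x. f (s \<otimes>\<^bsub>G\<^esub> x)) y = M f (s \<otimes>\<^bsub>G\<^esub> y)"
  using assms unfolding right_mean_def by blast+

lemma right_mean_sum:
  assumes "right_mean G M" "finite C"
  shows "M (\<lambda>x. \<Sum>c\<in>C. f c x) y = (\<Sum>c\<in>C. M (f c) y)"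
  using assms(2) by induction (simp_all add: right_mean_const[OF assms(1)] right_mean_add[OF assms(1)])

lemma right_mean_cong:
  assumes "right_mean G M" "\<And>x. x \<in> carrier G \<Longrightarrow> f x = g x" "y \<in> carrier G"
  shows "M f y = M g y"
  using right_mean_mono[OF assms(1), of f g y] right_mean_mono[OF assms(1), of g f y] assms(2,3)
  by fastforce

lemma right_mean_close:
  assumes M: "right_mean G M" and le: "\<And>x. x \<in> carrier G \<Longrightarrow> \<bar>f x - g x\<bar> \<le> e" and y: "y \<in> carrier G"
  shows "\<bar>M f y - M g y\<bar> \<le> e"
proof -
  have "M f y \<le> M (\<lambda>x. g x + e) y" "M g y \<le> M (\<lambda>x. f x + e) y"
    using le y by (intro right_mean_mono[OF M]; force simp: abs_le_iff)+
  then show ?thesis by (simp add: right_mean_add[OF M] right_mean_const[OF M])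
qed

lemma right_mean_id: "right_mean G (\<lambda>f. f)"
  by (simp add: right_mean_def)

lemma right_mean_comp:
  assumes M: "right_mean G M" and N: "right_mean G N"
  shows "right_mean G (\<lambda>f. M (N f))"
  unfolding right_mean_def
proof (intro conjI allI impI)
  show "M (N (\<lambda>x. f x + g x)) y = M (N f) y + M (N g) y" for f g y
    by (simp add: right_mean_add[OF M] right_mean_add[OF N, THEN ext])
  show "M (N f) y \<le> M (N g) y" if "\<forall>x\<in>carrier G. f x \<le> g x" "y \<in> carrier G" for f g y
    using that right_mean_mono[OF M] right_mean_mono[OF N] by meson
  show "M (N (\<lambda>_. c)) y = c" for c y
    by (simp add: right_mean_const[OF M] right_mean_const[OF N, THEN ext])
  show "M (N (\<lambda>x. f (s \<otimes>\<^bsub>G\<^esub> x))) y = M (N f) (s \<otimes>\<^bsub>G\<^esub> y)" if "s \<in> carrier G" "y \<in> carrier G" for f s y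
  proof -
    have "M (N (\<lambda>x. f (s \<otimes>\<^bsub>G\<^esub> x))) y = M (\<lambda>z. N f (s \<otimes>\<^bsub>G\<^esub> z)) y"
      using that right_mean_left_translate[OF N] by (intro right_mean_cong[OF M]) auto
    then show ?thesis using that right_mean_left_translate[OF M] by simp
  qed
qed

text \<open>Associativity makes right translations commute with left ones.\<close>

lemma (in group) right_mean_average:
  assumes "finite F" "F \<noteq> {}" "c ` F \<subseteq> carrier G"
  shows "right_mean G (\<lambda>f x. (\<Sum>i\<in>F. f (x \<otimes> c i)) / card F)"
  unfolding right_mean_def
proof (intro conjI allI impI)
  show "(\<Sum>i\<in>F. f (y \<otimes> c i)) / card F \<le> (\<Sum>i\<in>F. g (y \<otimes> c i)) / card F"
    if "\<forall>x\<in>carrier G. f x \<le> g x" "y \<in> carrier G" for f g :: "'a \<Rightarrow> real" and y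
    using that assms by (intro divide_right_mono sum_mono) auto
  show "(\<Sum>i\<in>F. f (s \<otimes> (y \<otimes> c i))) / card F = (\<Sum>i\<in>F. f (s \<otimes> y \<otimes> c i)) / card F"
    if "s \<in> carrier G" "y \<in> carrier G" for f :: "'a \<Rightarrow> real" and s y
    using that assms by (intro arg_cong2[where f="(/)"] sum.cong) (auto simp: m_assoc)
qed (use assms in \<open>auto simp: sum.distrib add_divide_distrib\<close>)

text \<open>Write \<open>x = u y\<close>. By right invariance of \<rho>, left translation by
  \<open>u\<close> moves every point by the same distance \<open>\<rho> x y\<close>, so
  \<open>f\<close> and its translate differ by at most \<open>e\<close> everywhere. \<open>M\<close>
  preserves this bound and commutes with the translation.\<close>

lemma (in group) right_mean_modulus:
  fixes \<rho> :: "'a \<Rightarrow> 'a \<Rightarrow> real"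
  assumes M: "right_mean G M"
    and inv: "\<And>x y z. \<lbrakk>x \<in> carrier G; y \<in> carrier G; z \<in> carrier G\<rbrakk> \<Longrightarrow> \<rho> (x \<otimes> z) (y \<otimes> z) = \<rho> x y"
    and f: "\<And>x y. \<lbrakk>x \<in> carrier G; y \<in> carrier G; \<rho> x y < \<delta>\<rbrakk> \<Longrightarrow> \<bar>f x - f y\<bar> \<le> e"
    and xy: "x \<in> carrier G" "y \<in> carrier G" "\<rho> x y < \<delta>"
  shows "\<bar>M f x - M f y\<bar> \<le> e"
proof -
  define u where "u = x \<otimes> inv y"
  have u: "u \<in> carrier G" "u \<otimes> y = x" using xy by (auto simp: u_def m_assoc)
  have "\<rho> (u \<otimes> z) z < \<delta>" if z: "z \<in> carrier G" for z
  proof -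
    have "\<rho> (u \<otimes> z) z = \<rho> u \<one>" using inv[of u \<one> z] u z by simp
    also have "\<dots> = \<rho> x y" using inv[of u \<one> y] u xy by simp
    finally show ?thesis using xy by simp
  qed
  then have "\<bar>M (\<lambda>z. f (u \<otimes> z)) y - M f y\<bar> \<le> e"
    using u xy by (intro right_mean_close[OF M] f) auto
  then show ?thesis using right_mean_left_translate[OF M u(1) xy(2)] u(2) by simp
qed

text \<open>Let \<open>I\<close> be the infimum of the oscillation bounds attainable by right means,
  and \<open>m\<close> the size of a finite \<delta>-net. The contraction step gives
  \<open>I \<le> (1 - 1/m) I + 2 e3/m\<close>, so \<open>I \<le> 2 e3 < e\<close>. This is a
  classical construction of the mean of an almost periodic function.\<close>

lemma (in group) right_mean_oscillation:
  fixes \<rho> :: "'a \<Rightarrow> 'a \<Rightarrow> real"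
  assumes inv: "\<And>x y z. \<lbrakk>x \<in> carrier G; y \<in> carrier G; z \<in> carrier G\<rbrakk> \<Longrightarrow> \<rho> (x \<otimes> z) (y \<otimes> z) = \<rho> x y"
    and tb: "\<And>\<delta>. 0 < \<delta> \<Longrightarrow> \<exists>F. finite F \<and> F \<subseteq> carrier G \<and> (\<forall>x\<in>carrier G. \<exists>y\<in>F. \<rho> x y < \<delta>)"
    and unif: "\<And>e. 0 < e \<Longrightarrow> \<exists>\<delta>>0. \<forall>x\<in>carrier G. \<forall>y\<in>carrier G. \<rho> x y < \<delta> \<longrightarrow> \<bar>f x - f y\<bar> \<le> e"
    and bdd: "\<And>x. x \<in> carrier G \<Longrightarrow> \<bar>f x\<bar> \<le> b"
    and e: "0 < e"
  shows "\<exists>M. right_mean G M \<and> (\<forall>x\<in>carrier G. \<forall>y\<in>carrier G. M f x - M f y \<le> e)"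
proof -
  define Osc where "Osc = {c. 0 \<le> c \<and>
      (\<exists>M. right_mean G M \<and> (\<forall>x\<in>carrier G. \<forall>y\<in>carrier G. M f x - M f y \<le> c))}"
  define e3 where "e3 = e / 3"
  have e3: "0 < e3" using e by (simp add: e3_def)
  obtain \<delta> where \<delta>: "0 < \<delta>"
      "\<And>x y. \<lbrakk>x \<in> carrier G; y \<in> carrier G; \<rho> x y < \<delta>\<rbrakk> \<Longrightarrow> \<bar>f x - f y\<bar> \<le> e3"
    using unif[OF e3] by metis
  obtain F where F: "finite F" "F \<subseteq> carrier G" "\<And>x. x \<in> carrier G \<Longrightarrow> \<exists>y\<in>F. \<rho> x y < \<delta>"
    using tb[OF \<delta>(1)] by metis
  have Fne: "F \<noteq> {}" using F(3)[OF one_closed] by blast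
  define m where "m = real (card F)"
  have m: "1 \<le> m" using F(1) Fne by (simp add: m_def card_gt_0_iff Suc_le_eq)
  \<comment> \<open>Averaging \<open>M f\<close> over the right translates sending each \<open>i \<in> F\<close> to an almost-maximum
    point \<open>p\<close> of \<open>M f\<close> contracts the oscillation: from every \<open>y\<close>, one of the translates is close to \<open>p\<close>.\<close>
  have step: "(1 - 1 / m) * c + 2 * e3 / m \<in> Osc" if c: "c \<in> Osc" for c
  proof -
    obtain M where M: "right_mean G M" and c0: "0 \<le> c"
      and osc: "\<And>x y. \<lbrakk>x \<in> carrier G; y \<in> carrier G\<rbrakk> \<Longrightarrow> M f x - M f y \<le> c"
      using c by (auto simp: Osc_def)
    define h where "h = M f"
    have hclose: "\<bar>h x - h y\<bar> \<le> e3" if "x \<in> carrier G" "y \<in> carrier G" "\<rho> x y < \<delta>" for x y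
      unfolding h_def using right_mean_modulus[of M \<rho> \<delta> f e3, OF M inv \<delta>(2) that] .
    have "\<exists>p\<in>carrier G. \<forall>z\<in>carrier G. h z \<le> h p + e3"
    proof -
      have bd: "bdd_above (h ` carrier G)"
        using osc[OF _ one_closed] by (intro bdd_aboveI2[of _ _ "h \<one> + c"]) (force simp: h_def)
      have "Sup (h ` carrier G) - e3 < Sup (h ` carrier G)" using e3 by simp
      then obtain p where p: "p \<in> carrier G" "Sup (h ` carrier G) - e3 < h p"
        using less_cSup_iff[OF _ bd, of "Sup (h ` carrier G) - e3"] by blast
      then have "h z \<le> h p + e3" if "z \<in> carrier G" for z
        using cSUP_upper[OF that bd] by linarith
      then show ?thesis using p by blast
    qed
    then obtain p where p: "p \<in> carrier G" "\<And>z. z \<in> carrier G \<Longrightarrow> h z \<le> h p + e3" by blast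
    define t where "t = (\<lambda>i. inv i \<otimes> p)"
    have t: "t i \<in> carrier G" if "i \<in> F" for i using that F p by (auto simp: t_def)
    define N where "N = (\<lambda>f x. (\<Sum>i\<in>F. f (x \<otimes> t i)) / card F)"
    have N: "right_mean G N" unfolding N_def
      using t F Fne by (intro right_mean_average) auto
    have "N h x - N h y \<le> (1 - 1 / m) * c + 2 * e3 / m" if xy: "x \<in> carrier G" "y \<in> carrier G" for x y
    proof -
      obtain j where j: "j \<in> F" "\<rho> y j < \<delta>" using F(3) xy by blast
      have jc: "j \<in> carrier G" using j F by blast
      have "\<rho> (y \<otimes> t j) p = \<rho> (y \<otimes> t j) (j \<otimes> t j)"
        using jc p by (simp add: t_def m_assoc[symmetric])
      also have "\<dots> < \<delta>" using inv[of y j "t j"] t[OF j(1)] xy jc j(2) by simp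
      finally have "\<bar>h (y \<otimes> t j) - h p\<bar> \<le> e3" using hclose p xy t[OF j(1)] by simp
      \<comment> \<open>One \<open>e3\<close> is the distance from
        \<open>h (y \<otimes> t j)\<close> to \<open>h p\<close>; the other is there because
        \<open>p\<close> is only an almost-maximum.\<close>
      then have hj: "h (x \<otimes> t j) - h (y \<otimes> t j) \<le> 2 * e3"
        using p(2)[of "x \<otimes> t j"] xy t[OF j(1)] by simp
      have "(\<Sum>i\<in>F. h (x \<otimes> t i) - h (y \<otimes> t i))
          = (h (x \<otimes> t j) - h (y \<otimes> t j)) + (\<Sum>i\<in>F-{j}. h (x \<otimes> t i) - h (y \<otimes> t i))"
        using F(1) j(1) by (rule sum.remove)
      also have "\<dots> \<le> 2 * e3 + (\<Sum>i\<in>F-{j}. c)"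
        using hj osc xy t by (intro add_mono sum_mono) (auto simp: h_def)
      also have "(\<Sum>i\<in>F-{j}. c) = (m - 1) * c"
        using card.remove[OF F(1) j(1)] by (simp add: m_def)
      finally have "(\<Sum>i\<in>F. h (x \<otimes> t i) - h (y \<otimes> t i)) / m \<le> (2 * e3 + (m - 1) * c) / m"
        using m by (intro divide_right_mono) auto
      then show ?thesis
        using m by (simp add: N_def m_def[symmetric] sum_subtractf diff_divide_distrib add_divide_distrib
            left_diff_distrib)
    qed
    moreover have "0 \<le> (1 - 1 / m) * c + 2 * e3 / m" using m c0 e3 by simp
    ultimately show ?thesis using right_mean_comp[OF N M] unfolding Osc_def h_def by blast
  qed
  define I where "I = Inf Osc"
  have bb: "bdd_below Osc" by (auto simp: Osc_def intro: bdd_belowI[of _ 0])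
  have "2 * b \<in> Osc"
  proof -
    have "f x - f y \<le> 2 * b" if "x \<in> carrier G" "y \<in> carrier G" for x y
      using bdd[OF that(1)] bdd[OF that(2)] by linarith
    moreover have "0 \<le> b" using bdd[OF one_closed] by linarith
    ultimately show ?thesis using right_mean_id by (auto simp: Osc_def)
  qed
  then have ne: "Osc \<noteq> {}" by blast
  have "I \<le> 2 * e3"
  proof -
    \<comment> \<open>The slack \<open>d\<close> allows for an infimum that is not attained.\<close>
    have "I * m \<le> (m - 1) * I + 2 * e3 + d" if "0 < d" for d
    proof -
      have "I < I + d / m" using m that by simp
      then obtain c where c: "c \<in> Osc" "c < I + d / m"
        unfolding I_def using cInf_less_iff[OF ne bb] by blast
      have "I \<le> (1 - 1 / m) * c + 2 * e3 / m"
        unfolding I_def using step[OF c(1)] bb by (rule cInf_lower)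
      then have "I * m \<le> ((1 - 1 / m) * c + 2 * e3 / m) * m" using m by (intro mult_right_mono) auto
      also have "\<dots> = (m - 1) * c + 2 * e3" using m by (simp add: field_simps)
      also have "(m - 1) * c \<le> (m - 1) * (I + d / m)" using m c by (intro mult_left_mono) auto
      also have "\<dots> \<le> (m - 1) * I + d" using m that by (simp add: field_simps)
      finally show ?thesis by simp
    qed
    then have "I * m \<le> (m - 1) * I + 2 * e3" by (rule field_le_epsilon)
    then show ?thesis by (simp add: algebra_simps)
  qed
  then have "I < e" using e by (simp add: e3_def)
  then obtain c where "c \<in> Osc" "c < e" unfolding I_def using cInf_less_iff[OF ne bb] by blast
  then show ?thesis unfolding Osc_def by (smt (verit) mem_Collect_eq)
qed

text \<open>Induction on \<open>B\<close>: \<open>M (f i)\<close> keeps the modulus of continuity of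
  \<open>f i\<close>, so the lemma for one function yields a further mean \<open>N\<close>, and
  \<open>N\<close> cannot enlarge the oscillations that \<open>M\<close> has already made
  small.\<close>

lemma (in group) right_mean_oscillation_family:
  fixes \<rho> :: "'a \<Rightarrow> 'a \<Rightarrow> real" and f :: "'i \<Rightarrow> 'a \<Rightarrow> real"
  assumes inv: "\<And>x y z. \<lbrakk>x \<in> carrier G; y \<in> carrier G; z \<in> carrier G\<rbrakk> \<Longrightarrow> \<rho> (x \<otimes> z) (y \<otimes> z) = \<rho> x y"
    and tb: "\<And>\<delta>. 0 < \<delta> \<Longrightarrow> \<exists>F. finite F \<and> F \<subseteq> carrier G \<and> (\<forall>x\<in>carrier G. \<exists>y\<in>F. \<rho> x y < \<delta>)"
    and "finite B"
    and unif: "\<And>i e. \<lbrakk>i \<in> B; 0 < e\<rbrakk> \<Longrightarrow> \<exists>\<delta>>0. \<forall>x\<in>carrier G. \<forall>y\<in>carrier G. \<rho> x y < \<delta> \<longrightarrow> \<bar>f i x - f i y\<bar> \<le> e"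
    and bdd: "\<And>i x. \<lbrakk>i \<in> B; x \<in> carrier G\<rbrakk> \<Longrightarrow> \<bar>f i x\<bar> \<le> b"
    and e: "0 < e"
  shows "\<exists>M. right_mean G M \<and> (\<forall>i\<in>B. \<forall>x\<in>carrier G. \<forall>y\<in>carrier G. \<bar>M (f i) x - M (f i) y\<bar> \<le> e)"
  using \<open>finite B\<close> unif bdd
proof (induction B)
  case empty
  then show ?case using right_mean_id by blast
next
  case (insert i B)
  obtain M where M: "right_mean G M"
    and osc: "\<And>j x y. \<lbrakk>j \<in> B; x \<in> carrier G; y \<in> carrier G\<rbrakk> \<Longrightarrow> \<bar>M (f j) x - M (f j) y\<bar> \<le> e"
    using insert.IH insert.prems by (metis insertCI)
  have "\<exists>N. right_mean G N \<and> (\<forall>x\<in>carrier G. \<forall>y\<in>carrier G. N (M (f i)) x - N (M (f i)) y \<le> e)"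
  proof (rule right_mean_oscillation[of \<rho>, OF inv tb _ _ e])
    fix d :: real assume "0 < d"
    then obtain \<delta> where \<delta>: "0 < \<delta>" "\<And>x y. \<lbrakk>x \<in> carrier G; y \<in> carrier G; \<rho> x y < \<delta>\<rbrakk> \<Longrightarrow> \<bar>f i x - f i y\<bar> \<le> d"
      using insert.prems(1)[of i d] by auto
    have "\<bar>M (f i) x - M (f i) y\<bar> \<le> d" if "x \<in> carrier G" "y \<in> carrier G" "\<rho> x y < \<delta>" for x y
      using right_mean_modulus[of M \<rho> \<delta> "f i" d, OF M inv \<delta>(2) that] .
    then show "\<exists>\<delta>>0. \<forall>x\<in>carrier G. \<forall>y\<in>carrier G. \<rho> x y < \<delta> \<longrightarrow> \<bar>M (f i) x - M (f i) y\<bar> \<le> d"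
      using \<delta>(1) by blast
  next
    show "\<bar>M (f i) x\<bar> \<le> b" if "x \<in> carrier G" for x
      using right_mean_close[OF M, of "f i" "\<lambda>_. 0" b x] insert.prems(2)[of i] that
      by (simp add: right_mean_const[OF M])
  qed
  then obtain N where N: "right_mean G N"
    and oscN: "\<And>x y. \<lbrakk>x \<in> carrier G; y \<in> carrier G\<rbrakk> \<Longrightarrow> N (M (f i)) x - N (M (f i)) y \<le> e" by blast
  \<comment> \<open>With \<rho> replaced by 0 all pairs are close, so the modulus lemma transfers a
    bound on all differences.\<close>
  have oscB: "\<bar>N (M (f j)) x - N (M (f j)) y\<bar> \<le> e"
    if "j \<in> B" "x \<in> carrier G" "y \<in> carrier G" for j x y
    by (rule right_mean_modulus[where \<rho> = "\<lambda>_ _. 0" and \<delta> = 1, OF N]) (use osc that in auto)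
  have "\<bar>N (M (f j)) x - N (M (f j)) y\<bar> \<le> e"
    if "j \<in> insert i B" "x \<in> carrier G" "y \<in> carrier G" for j x y
    using that oscB oscN[of x y] oscN[of y x] by (cases "j = i") (auto simp: abs_le_iff)
  then show ?case using right_mean_comp[OF N M] by blast
qed

section \<open>Lower bounds for warped metrics\<close>

text \<open>The maximum of \<open>min d 1\<close> and \<open>\<bar>u x - u y\<bar>\<close> is itself
  a candidate for the warped metric, hence below the greatest one. The term \<open>min d 1\<close>
  makes it separate points.\<close>

lemma warped_lower_bound:
  fixes u :: "'a \<Rightarrow> real"
  assumes W: "is_warped_metric m act S W"
    and lip: "\<And>x y. \<lbrakk>x \<in> mspace m; y \<in> mspace m\<rbrakk> \<Longrightarrow> \<bar>u x - u y\<bar> \<le> mdist m x y"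
    and jump: "\<And>x s. \<lbrakk>x \<in> mspace m; s \<in> S\<rbrakk> \<Longrightarrow> \<bar>u x - u (act s x)\<bar> \<le> 1"
    and xy: "x \<in> mspace m" "y \<in> mspace m"
  shows "\<bar>u x - u y\<bar> \<le> mdist W x y" "min (mdist m x y) 1 \<le> mdist W x y"
proof -
  define D where "D = (\<lambda>x y. max (min (mdist m x y) 1) \<bar>u x - u y\<bar>)"
  interpret Metric_space "mspace m" D
  proof
    show "D x y = D y x" for x y by (simp add: D_def mdist_commute abs_minus_commute)
    show "0 \<le> D x y" for x y by (simp add: D_def)
    fix x y assume xy: "x \<in> mspace m" "y \<in> mspace m"
    show "D x y = 0 \<longleftrightarrow> x = y"
    proof
      assume "D x y = 0"
      then have "mdist m x y \<le> 0" unfolding D_def by linarith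
      then show "x = y" using mdist_zero[OF xy] mdist_nonneg[of m x y] by linarith
    next
      assume "x = y"
      moreover from this have "mdist m x y = 0" using mdist_zero[OF xy] by simp
      ultimately show "D x y = 0" by (simp add: D_def)
    qed
    fix z assume z: "z \<in> mspace m"
    show "D x z \<le> D x y + D y z"
      using mdist_triangle[OF xy z] mdist_nonneg[of m x y] mdist_nonneg[of m y z]
      unfolding D_def by linarith
  qed
  have "metric (mspace m, D) \<in> warped_candidates m act S"
    using lip jump by (auto simp: warped_candidates_def, auto simp: D_def)
  then have "mdist (metric (mspace m, D)) x y \<le> mdist W x y"
    using W xy unfolding is_warped_metric_def by blast
  then have "D x y \<le> mdist W x y" by simp
  then show "\<bar>u x - u y\<bar> \<le> mdist W x y" "min (mdist m x y) 1 \<le> mdist W x y" by (auto simp: D_def)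
qed

lemma
  assumes "is_warped_metric m act S W"
  shows warped_mspace: "mspace W = mspace m"
    and warped_le: "\<lbrakk>x \<in> mspace m; y \<in> mspace m\<rbrakk> \<Longrightarrow> mdist W x y \<le> mdist m x y"
    and warped_jump: "\<lbrakk>x \<in> mspace m; s \<in> S\<rbrakk> \<Longrightarrow> mdist W x (act s x) \<le> 1"
  using assms by (auto simp: is_warped_metric_def warped_candidates_def)

text \<open>The warped metric lies between \<open>min d 1\<close> and \<open>d\<close>. Hence
  continuity and the test functions in property A refer to the Euclidean topology of the
  cone.\<close>

lemma warped_topology:
  assumes W: "is_warped_metric m act S W"
  shows "mtopology_of W = mtopology_of m"
proof -
  interpret m: Metric_space "mspace m" "mdist m" by simp
  interpret W: Metric_space "mspace m" "mdist W"
    using Metric_space_mspace_mdist[of W] by (simp add: warped_mspace[OF W])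
  have "(\<exists>r>0. W.mball x r \<subseteq> U) \<longleftrightarrow> (\<exists>r>0. m.mball x r \<subseteq> U)" if "x \<in> mspace m" for x U
  proof
    assume "\<exists>r>0. W.mball x r \<subseteq> U"
    then obtain r where "0 < r" "W.mball x r \<subseteq> U" by blast
    moreover have "m.mball x r \<subseteq> W.mball x r"
      using warped_le[OF W] by (force simp: m.in_mball W.in_mball)
    ultimately show "\<exists>r>0. m.mball x r \<subseteq> U" by blast
  next
    assume "\<exists>r>0. m.mball x r \<subseteq> U"
    then obtain r where r: "0 < r" "m.mball x r \<subseteq> U" by blast
    have "W.mball x (min r 1) \<subseteq> m.mball x r"
    proof
      fix y assume "y \<in> W.mball x (min r 1)"
      then have y: "y \<in> mspace m" "mdist W x y < min r 1" by auto
      have "min (mdist m x y) 1 \<le> mdist W x y"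
        using that y by (intro warped_lower_bound(2)[OF W, of "\<lambda>_. 0"]) auto
      then show "y \<in> m.mball x r" using y that by auto
    qed
    then show "\<exists>r>0. W.mball x r \<subseteq> U" using r by (intro exI[of _ "min r 1"]) auto
  qed
  then have "W.mtopology = m.mtopology"
    unfolding topology_eq W.openin_mtopology m.openin_mtopology by blast
  then show ?thesis by (simp add: mtopology_of_def warped_mspace[OF W])
qed

section \<open>Compact groups in Euclidean space\<close>

text \<open>A compact topological group seen through its image in the unit sphere: multiplication is
  transported along \<iota>, so its continuity concerns subsets of Euclidean space.\<close>

locale embedded_group = group G for G (structure) +
  fixes \<iota> :: "'a \<Rightarrow> 'e::euclidean_space"
  assumes inj: "inj_on \<iota> (carrier G)"
    and sphere: "\<iota> ` carrier G \<subseteq> sphere 0 1"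
    and cpt: "compact (\<iota> ` carrier G)"
    and cont: "continuous_on (\<iota> ` carrier G \<times> \<iota> ` carrier G)
      (\<lambda>p. \<iota> (inv_into (carrier G) \<iota> (fst p) \<otimes> inv_into (carrier G) \<iota> (snd p)))"
begin

text \<open>Taking the supremum over all two-sided translates turns the Euclidean distance into a
  bi-invariant metric on the group.\<close>

definition \<rho> :: "'a \<Rightarrow> 'a \<Rightarrow> real" where
  "\<rho> x y = (SUP p \<in> carrier G \<times> carrier G. dist (\<iota> (fst p \<otimes> x \<otimes> snd p)) (\<iota> (fst p \<otimes> y \<otimes> snd p)))"

lemma norm_\<iota> [simp]: "x \<in> carrier G \<Longrightarrow> norm (\<iota> x) = 1"
  using sphere by auto

lemma \<rho>_upper:
  assumes "a \<in> carrier G" "b \<in> carrier G" "x \<in> carrier G" "y \<in> carrier G"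
  shows "dist (\<iota> (a \<otimes> x \<otimes> b)) (\<iota> (a \<otimes> y \<otimes> b)) \<le> \<rho> x y"
proof -
  have "bdd_above ((\<lambda>p. dist (\<iota> (fst p \<otimes> x \<otimes> snd p)) (\<iota> (fst p \<otimes> y \<otimes> snd p))) ` (carrier G \<times> carrier G))"
  proof (rule bdd_aboveI2)
    fix p assume "p \<in> carrier G \<times> carrier G"
    then show "dist (\<iota> (fst p \<otimes> x \<otimes> snd p)) (\<iota> (fst p \<otimes> y \<otimes> snd p)) \<le> 2"
      using assms norm_triangle_ineq4[of "\<iota> (fst p \<otimes> x \<otimes> snd p)" "\<iota> (fst p \<otimes> y \<otimes> snd p)"]
      by (auto simp: dist_norm)
  qed
  from cSUP_upper[OF _ this, of "(a, b)"] show ?thesis using assms by (simp add: \<rho>_def)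
qed

lemma \<rho>_least:
  assumes "\<And>a b. \<lbrakk>a \<in> carrier G; b \<in> carrier G\<rbrakk> \<Longrightarrow> dist (\<iota> (a \<otimes> x \<otimes> b)) (\<iota> (a \<otimes> y \<otimes> b)) \<le> c"
  shows "\<rho> x y \<le> c"
  unfolding \<rho>_def using assms by (intro cSUP_least) auto

lemma dist_le_\<rho>: "\<lbrakk>x \<in> carrier G; y \<in> carrier G\<rbrakk> \<Longrightarrow> dist (\<iota> x) (\<iota> y) \<le> \<rho> x y"
  using \<rho>_upper[of \<one> \<one> x y] by simp

lemma \<rho>_self: "\<rho> x x = 0"
  using one_closed unfolding \<rho>_def by (subst dist_self, intro cSUP_const) auto

lemma \<rho>_sym: "\<rho> x y = \<rho> y x"
  unfolding \<rho>_def by (simp add: dist_commute)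

lemma \<rho>_pos: "\<lbrakk>x \<in> carrier G; y \<in> carrier G; x \<noteq> y\<rbrakk> \<Longrightarrow> 0 < \<rho> x y"
  using dist_le_\<rho>[of x y] inj by (metis inj_onD zero_less_dist_iff order_less_le_trans)

lemma \<rho>_triangle:
  assumes "x \<in> carrier G" "y \<in> carrier G" "z \<in> carrier G"
  shows "\<rho> x z \<le> \<rho> x y + \<rho> y z"
proof (rule \<rho>_least)
  fix a b assume ab: "a \<in> carrier G" "b \<in> carrier G"
  show "dist (\<iota> (a \<otimes> x \<otimes> b)) (\<iota> (a \<otimes> z \<otimes> b)) \<le> \<rho> x y + \<rho> y z"
    using \<rho>_upper[OF ab assms(1,2)] \<rho>_upper[OF ab assms(2,3)]
      dist_triangle[of "\<iota> (a \<otimes> x \<otimes> b)" "\<iota> (a \<otimes> z \<otimes> b)" "\<iota> (a \<otimes> y \<otimes> b)"] by linarith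
qed

lemma \<rho>_mult_le:
  assumes "x \<in> carrier G" "y \<in> carrier G" "u \<in> carrier G" "v \<in> carrier G"
  shows "\<rho> (u \<otimes> x \<otimes> v) (u \<otimes> y \<otimes> v) \<le> \<rho> x y"
proof (rule \<rho>_least)
  fix a b assume ab: "a \<in> carrier G" "b \<in> carrier G"
  have "a \<otimes> (u \<otimes> z \<otimes> v) \<otimes> b = (a \<otimes> u) \<otimes> z \<otimes> (v \<otimes> b)" if "z \<in> carrier G" for z
    using ab assms that by (simp add: m_assoc)
  then show "dist (\<iota> (a \<otimes> (u \<otimes> x \<otimes> v) \<otimes> b)) (\<iota> (a \<otimes> (u \<otimes> y \<otimes> v) \<otimes> b)) \<le> \<rho> x y"
    using \<rho>_upper[of "a \<otimes> u" "v \<otimes> b" x y] ab assms by simp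
qed

lemma \<rho>_left:
  assumes "x \<in> carrier G" "y \<in> carrier G" "u \<in> carrier G"
  shows "\<rho> (u \<otimes> x) (u \<otimes> y) = \<rho> x y"
proof (rule antisym)
  show "\<rho> (u \<otimes> x) (u \<otimes> y) \<le> \<rho> x y" using \<rho>_mult_le[of x y u \<one>] assms by simp
  show "\<rho> x y \<le> \<rho> (u \<otimes> x) (u \<otimes> y)"
    using \<rho>_mult_le[of "u \<otimes> x" "u \<otimes> y" "inv u" \<one>] assms by (simp add: m_assoc[symmetric])
qed

lemma \<rho>_right:
  assumes "x \<in> carrier G" "y \<in> carrier G" "u \<in> carrier G"
  shows "\<rho> (x \<otimes> u) (y \<otimes> u) = \<rho> x y"
proof (rule antisym)
  show "\<rho> (x \<otimes> u) (y \<otimes> u) \<le> \<rho> x y" using \<rho>_mult_le[of x y \<one> u] assms by simp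
  show "\<rho> x y \<le> \<rho> (x \<otimes> u) (y \<otimes> u)"
    using \<rho>_mult_le[of "x \<otimes> u" "y \<otimes> u" \<one> "inv u"] assms by (simp add: m_assoc)
qed

text \<open>The triple product is uniformly continuous on the compact cube of the image, so all
  translates of a close pair are close simultaneously. With \<open>dist_le_\<rho>\<close>, this
  shows that \<rho> and the Euclidean distance define the same uniform structure.\<close>

lemma \<rho>_uniform:
  assumes "0 < e"
  shows "\<exists>d>0. \<forall>x\<in>carrier G. \<forall>y\<in>carrier G. dist (\<iota> x) (\<iota> y) < d \<longrightarrow> \<rho> x y < e"
proof -
  let ?K = "\<iota> ` carrier G" and ?j = "inv_into (carrier G) \<iota>"
  define mu where "mu = (\<lambda>p. \<iota> (?j (fst p) \<otimes> ?j (snd p)))"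
  have mu: "mu (\<iota> x, \<iota> y) = \<iota> (x \<otimes> y)" if "x \<in> carrier G" "y \<in> carrier G" for x y
    using that inj by (simp add: mu_def)
  have mu_in: "mu p \<in> ?K" if "p \<in> ?K \<times> ?K" for p
    using that mu by force
  have mu_cont: "continuous_on (?K \<times> ?K) mu" using cont by (simp add: mu_def)
  define f where "f = (\<lambda>q. mu (mu (fst q, fst (snd q)), snd (snd q)))"
  have "continuous_on (?K \<times> ?K \<times> ?K) (\<lambda>q. mu (fst q, fst (snd q)))"
    by (rule continuous_on_compose2[OF mu_cont]) (auto intro!: continuous_intros)
  then have "continuous_on (?K \<times> ?K \<times> ?K) f" unfolding f_def
    by (intro continuous_on_compose2[OF mu_cont] continuous_on_Pair)
      (auto intro!: continuous_intros mu_in)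
  then have "uniformly_continuous_on (?K \<times> ?K \<times> ?K) f"
    using cpt by (intro compact_uniformly_continuous compact_Times)
  then obtain d where d: "0 < d" "\<And>p q. \<lbrakk>p \<in> ?K \<times> ?K \<times> ?K; q \<in> ?K \<times> ?K \<times> ?K; dist p q < d\<rbrakk>
      \<Longrightarrow> dist (f p) (f q) < e / 2"
    unfolding uniformly_continuous_on_def using assms half_gt_zero[OF assms] by metis
  have "\<rho> x y < e" if xy: "x \<in> carrier G" "y \<in> carrier G" "dist (\<iota> x) (\<iota> y) < d" for x y
  proof -
    have "\<rho> x y \<le> e / 2"
    proof (rule \<rho>_least)
      fix a b assume ab: "a \<in> carrier G" "b \<in> carrier G"
      have "dist (f (\<iota> a, \<iota> x, \<iota> b)) (f (\<iota> a, \<iota> y, \<iota> b)) < e / 2"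
        using ab xy by (intro d(2)) (auto simp: dist_Pair_Pair)
      then show "dist (\<iota> (a \<otimes> x \<otimes> b)) (\<iota> (a \<otimes> y \<otimes> b)) \<le> e / 2"
        using ab xy by (simp add: f_def mu)
    qed
    then show ?thesis using assms by linarith
  qed
  then show ?thesis using d(1) by blast
qed

lemma \<rho>_totally_bounded:
  assumes "0 < e"
  shows "\<exists>F. finite F \<and> F \<subseteq> carrier G \<and> (\<forall>x\<in>carrier G. \<exists>y\<in>F. \<rho> x y < e)"
proof -
  obtain d where d: "0 < d" "\<And>x y. \<lbrakk>x \<in> carrier G; y \<in> carrier G; dist (\<iota> x) (\<iota> y) < d\<rbrakk> \<Longrightarrow> \<rho> x y < e"
    using \<rho>_uniform[OF assms] by metis
  obtain k where k: "finite k" "k \<subseteq> \<iota> ` carrier G" "\<iota> ` carrier G \<subseteq> (\<Union>x\<in>k. ball x d)"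
    using seq_compact_imp_totally_bounded[OF cpt[unfolded compact_eq_seq_compact_metric], rule_format, OF d(1)]
    by (elim exE conjE) (rule that)
  obtain F where F: "F \<subseteq> carrier G" "finite F" "k = \<iota> ` F"
    using k(1,2) by (meson finite_subset_image)
  have "\<exists>y\<in>F. \<rho> x y < e" if "x \<in> carrier G" for x
  proof -
    have "\<iota> x \<in> (\<Union>x\<in>k. ball x d)" using that k(3) by blast
    then obtain y where "y \<in> F" "dist (\<iota> y) (\<iota> x) < d" unfolding F(3) by auto
    then show ?thesis using d(2)[of x y] F(1) that by (auto simp: dist_commute)
  qed
  then show ?thesis using F by blast
qed

lemma \<iota>_uniform_imp_\<rho>:
  assumes "continuous_on (\<iota> ` carrier G) (f \<circ> inv_into (carrier G) \<iota>)" "0 < e"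
  shows "\<exists>d>0. \<forall>x\<in>carrier G. \<forall>y\<in>carrier G. \<rho> x y < d \<longrightarrow> dist (f x) (f y) < e"
proof -
  have "uniformly_continuous_on (\<iota> ` carrier G) (f \<circ> inv_into (carrier G) \<iota>)"
    using assms(1) cpt by (rule compact_uniformly_continuous)
  then obtain d where d: "0 < d" "\<And>u v. \<lbrakk>u \<in> \<iota> ` carrier G; v \<in> \<iota> ` carrier G; dist u v < d\<rbrakk>
      \<Longrightarrow> dist ((f \<circ> inv_into (carrier G) \<iota>) u) ((f \<circ> inv_into (carrier G) \<iota>) v) < e"
    unfolding uniformly_continuous_on_def using assms(2) by metis
  have "dist (f x) (f y) < e" if "x \<in> carrier G" "y \<in> carrier G" "\<rho> x y < d" for x y
    using d(2)[of "\<iota> x" "\<iota> y"] that dist_le_\<rho>[of x y] inj by simp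
  then show ?thesis using d(1) by blast
qed

text \<open>The ball of radius \<open>k\<close> in the word metric of \<open>S\<close>; letters are
  added on the left, as the group acts from the left.\<close>

primrec word_ball :: "'a set \<Rightarrow> nat \<Rightarrow> 'a set" where
  "word_ball S 0 = {\<one>}"
| "word_ball S (Suc k) = word_ball S k \<union>
     (\<Union>s\<in>S. (\<lambda>b. s \<otimes> b) ` word_ball S k \<union> (\<lambda>b. inv s \<otimes> b) ` word_ball S k)"

lemma finite_word_ball: "finite S \<Longrightarrow> finite (word_ball S k)"
  by (induction k) auto

lemma word_ball_subgroup: "\<lbrakk>subgroup H G; S \<subseteq> H\<rbrakk> \<Longrightarrow> word_ball S k \<subseteq> H"
  by (induction k) (auto simp: subgroup.one_closed subgroup.m_closed subgroup.m_inv_closed subset_iff)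

lemma word_ball_mono: "k \<le> l \<Longrightarrow> word_ball S k \<subseteq> word_ball S l"
  by (induction l rule: nat_induct) (auto simp: le_Suc_eq)

end

section \<open>The warped metric on the cone over an embedded group\<close>

locale warped_group = embedded_group G \<iota>
  for G :: "('g, 'm) monoid_scheme" (structure) and \<iota> :: "'g \<Rightarrow> 'e::euclidean_space" +
  fixes S :: "'g set" and W :: "'e metric"
  assumes S: "S \<subseteq> carrier G"
    and W: "is_warped_metric (submetric euclidean_metric (open_cone (\<iota> ` carrier G)))
           (cone_action (carrier G) \<iota> (\<lambda>\<gamma> y. \<gamma> \<otimes> y)) S W"
begin

definition "X = open_cone (\<iota> ` carrier G)"

lemma mspace_W: "mspace W = X"
  using warped_mspace[OF W] by (simp add: X_def)

lemma mtopology_W: "mtopology_of W = top_of_set X"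
  using warped_topology[OF W] by (simp add: X_def mtopology_of_submetric)

lemma cone_point: "\<lbrakk>0 \<le> t; g \<in> carrier G\<rbrakk> \<Longrightarrow> t *\<^sub>R \<iota> g \<in> X"
  by (auto simp: X_def open_cone_def)

lemma cone_pointE:
  assumes "z \<in> X"
  obtains t g where "0 \<le> t" "g \<in> carrier G" "z = t *\<^sub>R \<iota> g"
  using assms by (auto simp: X_def open_cone_def)

lemma cone_translate:
  "\<lbrakk>0 \<le> t; g \<in> carrier G\<rbrakk> \<Longrightarrow>
    cone_action (carrier G) \<iota> (\<lambda>\<gamma> y. \<gamma> \<otimes> y) s (t *\<^sub>R \<iota> g) = t *\<^sub>R \<iota> (s \<otimes> g)"
  by (rule cone_action_eq[OF inj sphere])

text \<open>One-sided estimates suffice: exchanging the points reverses the Lipschitz bound, and the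
  jump along \<open>inv s\<close> from the point over \<open>s \<otimes> g\<close> reverses the jump
  along \<open>s\<close>.\<close>

lemma W_lower:
  fixes u :: "'e \<Rightarrow> real"
  assumes lip: "\<And>x y. \<lbrakk>x \<in> X; y \<in> X\<rbrakk> \<Longrightarrow> u x \<le> u y + dist x y"
    and jump: "\<And>s t g. \<lbrakk>s \<in> S; 0 \<le> t; g \<in> carrier G\<rbrakk> \<Longrightarrow>
      u (t *\<^sub>R \<iota> (s \<otimes> g)) \<le> u (t *\<^sub>R \<iota> g) + 1 \<and> u (t *\<^sub>R \<iota> (inv s \<otimes> g)) \<le> u (t *\<^sub>R \<iota> g) + 1"
    and xy: "x \<in> X" "y \<in> X"
  shows "\<bar>u x - u y\<bar> \<le> mdist W x y"
proof (rule warped_lower_bound(1)[OF W])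
  show "\<bar>u x - u y\<bar> \<le> mdist (submetric euclidean_metric (open_cone (\<iota> ` carrier G))) x y"
    if "x \<in> mspace (submetric euclidean_metric (open_cone (\<iota> ` carrier G)))"
       "y \<in> mspace (submetric euclidean_metric (open_cone (\<iota> ` carrier G)))" for x y
    using lip[of x y] lip[of y x] that by (simp add: X_def dist_commute abs_le_iff)
  show "\<bar>u x - u (cone_action (carrier G) \<iota> (\<lambda>\<gamma> y. \<gamma> \<otimes> y) s x)\<bar> \<le> 1"
    if x: "x \<in> mspace (submetric euclidean_metric (open_cone (\<iota> ` carrier G)))" and s: "s \<in> S" for x s
  proof -
    have "x \<in> X" using x by (simp add: X_def)
    then obtain t g where tg: "0 \<le> t" "g \<in> carrier G" "x = t *\<^sub>R \<iota> g" by (rule cone_pointE)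
    have sc: "s \<in> carrier G" using s S by blast
    have "inv s \<otimes> (s \<otimes> g) = g" using sc tg by (simp add: m_assoc[symmetric])
    then show ?thesis
      using jump[OF s tg(1), of g] jump[OF s tg(1), of "s \<otimes> g"] tg sc
      by (simp add: cone_translate abs_le_iff)
  qed
qed (use xy in \<open>simp_all add: X_def\<close>)

text \<open>The norm is 1-Lipschitz and unchanged by the action.\<close>

lemma W_norm:
  assumes "x \<in> X" "y \<in> X"
  shows "\<bar>norm x - norm y\<bar> \<le> mdist W x y"
proof (rule W_lower[OF _ _ assms])
  show "norm x \<le> norm y + dist x y" for x y :: 'e
    using norm_triangle_ineq2[of x y] by (simp add: dist_norm)
qed (use S in \<open>auto simp: subset_iff\<close>)

lemma W_generator: "\<lbrakk>s \<in> S; 0 \<le> t; g \<in> carrier G\<rbrakk> \<Longrightarrow> mdist W (t *\<^sub>R \<iota> g) (t *\<^sub>R \<iota> (s \<otimes> g)) \<le> 1"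
  using warped_jump[OF W, of "t *\<^sub>R \<iota> g" s] cone_point[of t g] by (simp add: cone_translate X_def)

text \<open>Fix \<open>x\<^sub>0 = t \<iota>(g)\<close>. The sets \<open>E k\<close> grow so that \<open>E (k + 1)\<close> contains all generator translates
  of the \<open>R\<close>-neighbourhood of \<open>E k\<close>; hence the function that is the minimum of \<open>R\<close> and of all
  \<open>k + d(y, E k)\<close> is 1-Lipschitz and moves by at most 1 along generators, so it bounds the warped
  distance to \<open>x\<^sub>0\<close> from below.\<close>

lemma warped_ball_concentrated:
  fixes R :: nat
  assumes "0 < \<eta>"
  shows "\<exists>t0. \<forall>t\<ge>t0. \<forall>g\<in>carrier G. \<forall>h\<in>carrier G. \<forall>t'\<ge>0.
    mdist W (t *\<^sub>R \<iota> g) (t' *\<^sub>R \<iota> h) < R \<longrightarrow> (\<exists>b\<in>word_ball S R. \<rho> h (b \<otimes> g) \<le> \<eta>)"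
proof -
  \<comment> \<open>Each step costs \<open>e\<close> in \<rho>; there are at most \<open>R\<close>
    growth steps of \<open>E\<close> and one final neighbourhood.\<close>
  define e where "e = \<eta> / (real R + 1)"
  have e: "0 < e" using assms by (simp add: e_def)
  obtain d where d: "0 < d" "\<And>x y. \<lbrakk>x \<in> carrier G; y \<in> carrier G; dist (\<iota> x) (\<iota> y) < d\<rbrakk> \<Longrightarrow> \<rho> x y < e"
    using \<rho>_uniform[OF e] by metis
  \<comment> \<open>\<open>R * R\<close> is the radius that can be lost over \<open>R\<close> steps.
    Beyond \<open>2 * R / d\<close>, points of the cone less than \<open>2 * R\<close> apart at
    equal radius have directions less than \<open>d\<close> apart.\<close>
  define t0 where "t0 = real R * R + 2 * R / d + 1"
  have WB: "word_ball S k \<subseteq> carrier G" for k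
    using word_ball_subgroup[OF subgroup_self S] .
  have "\<exists>b\<in>word_ball S R. \<rho> h (b \<otimes> g) \<le> \<eta>"
    if t: "t0 \<le> t" and g: "g \<in> carrier G" and h: "h \<in> carrier G" and t': "0 \<le> t'"
      and less: "mdist W (t *\<^sub>R \<iota> g) (t' *\<^sub>R \<iota> h) < R" for t g h t'
  proof -
    define E where "E = (\<lambda>k::nat. {s *\<^sub>R \<iota> h |s h. h \<in> carrier G \<and> t - real k * R \<le> s \<and> 0 \<le> s \<and>
        (\<exists>b\<in>word_ball S k. \<rho> h (b \<otimes> g) \<le> k * e)})"
    have "0 \<le> real R * R" "0 \<le> 2 * R / d" using d(1) by simp_all
    then have t_pos: "0 < t" using t unfolding t0_def by linarith
    \<comment> \<open>Moving by less than \<open>R\<close> from a point of \<open>E k\<close>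
      changes the radius by less than \<open>R\<close> and the direction by less than
      \<open>e\<close> in \<rho>.\<close>
    have near: "t - (real k + 1) * R \<le> s \<and> (\<exists>b\<in>word_ball S k. \<rho> h (b \<otimes> g) \<le> (real k + 1) * e)"
      if k: "k \<le> R" and z: "z \<in> E k" and s: "0 \<le> s" and h: "h \<in> carrier G"
        and dz: "dist (s *\<^sub>R \<iota> h) z < R" for k z s h
    proof -
      obtain s' h' b where z': "z = s' *\<^sub>R \<iota> h'" "h' \<in> carrier G" "t - real k * R \<le> s'" "0 \<le> s'"
          "b \<in> word_ball S k" "\<rho> h' (b \<otimes> g) \<le> k * e"
        using z by (auto simp: E_def)
      have bG: "b \<in> carrier G" using z'(5) WB by blast
      have ss: "\<bar>s - s'\<bar> < R"
      proof -
        have "\<bar>norm (s *\<^sub>R \<iota> h) - norm z\<bar> \<le> dist (s *\<^sub>R \<iota> h) z"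
          unfolding dist_norm by (rule norm_triangle_ineq3)
        then show ?thesis using dz s h z' by simp
      qed
      have "real k * R \<le> real R * R" using k by (intro mult_right_mono) auto
      then have s': "2 * R / d < s'" using z'(3) t by (simp add: t0_def)
      \<comment> \<open>Both directions are compared at the radius \<open>s'\<close>; going there
        radially costs less than \<open>R\<close> again.\<close>
      have "s' * dist (\<iota> h) (\<iota> h') = dist (s' *\<^sub>R \<iota> h) z"
        using z'(1,4) by (simp add: dist_norm flip: scaleR_diff_right)
      also have "\<dots> \<le> dist (s' *\<^sub>R \<iota> h) (s *\<^sub>R \<iota> h) + dist (s *\<^sub>R \<iota> h) z" by (rule dist_triangle)
      also have "dist (s' *\<^sub>R \<iota> h) (s *\<^sub>R \<iota> h) = \<bar>s' - s\<bar>"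
        using h by (simp add: dist_norm flip: scaleR_diff_left)
      finally have "s' * dist (\<iota> h) (\<iota> h') < 2 * R" using ss dz by linarith
      also have "2 * R < s' * d" using s' d(1) by (simp add: field_simps)
      finally have "dist (\<iota> h) (\<iota> h') < d" using z'(4) mult_less_cancel_left_pos by (metis mult_left_mono not_le)
      then have "\<rho> h h' < e" using d(2) h z'(2) by blast
      then have "\<rho> h (b \<otimes> g) \<le> (real k + 1) * e"
        using \<rho>_triangle[of h h' "b \<otimes> g"] h z'(2,6) bG g by (simp add: algebra_simps)
      moreover have "t - (real k + 1) * R \<le> s" using ss z'(3) by (simp add: algebra_simps)
      ultimately show ?thesis using z'(5) by blast
    qed
    have jump: "s *\<^sub>R \<iota> (a \<otimes> h) \<in> E (Suc k)"
      if k: "k \<le> R" and z: "z \<in> E k" and s: "0 \<le> s" and h: "h \<in> carrier G"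
        and dz: "dist (s *\<^sub>R \<iota> h) z < R" and a: "a \<in> S \<union> (\<lambda>s. inv s) ` S" for k z s h a
    proof -
      obtain b where b: "t - (real k + 1) * R \<le> s" "b \<in> word_ball S k" "\<rho> h (b \<otimes> g) \<le> (real k + 1) * e"
        using near[OF k z s h dz] by blast
      have aG: "a \<in> carrier G" using a S by auto
      have bG: "b \<in> carrier G" using b(2) WB by blast
      have "\<rho> (a \<otimes> h) ((a \<otimes> b) \<otimes> g) = \<rho> h (b \<otimes> g)"
        using \<rho>_left[of h "b \<otimes> g" a] aG bG g h by (simp add: m_assoc)
      moreover have "a \<otimes> b \<in> word_ball S (Suc k)" using a b(2) by auto
      ultimately show ?thesis using b s h aG unfolding E_def
        by (auto simp: algebra_simps intro!: exI[of _ s] exI[of _ "a \<otimes> h"] bexI[of _ "a \<otimes> b"])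
    qed
    \<comment> \<open>The element \<open>R\<close> caps the infimum, so that only the sets
      \<open>E k\<close> with \<open>k \<le> R\<close> enter.\<close>
    define U where "U = (\<lambda>y. {real k + dist y z |k z. k \<le> R \<and> z \<in> E k} \<union> {real R})"
    define u where "u = (\<lambda>y. Inf (U y))"
    have Ubdd: "bdd_below (U y)" for y by (rule bdd_belowI[of _ 0]) (auto simp: U_def)
    have Une: "U y \<noteq> {}" for y by (simp add: U_def)
    have u_le: "u y \<le> c" if "c \<in> U y" for y c
      unfolding u_def using that Ubdd by (rule cInf_lower)
    have uR: "u y \<le> R" for y by (rule u_le) (simp add: U_def)
    have u_cases: "\<exists>k z. k \<le> R \<and> z \<in> E k \<and> real k + dist y z < c" if "u y < c" "c \<le> R" for y c
    proof -
      have "\<exists>a\<in>U y. a < c" using that(1) cInf_less_iff[OF Une Ubdd, of y c] unfolding u_def by simp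
      then show ?thesis using that(2) by (auto simp: U_def)
    qed
    have lip: "u x \<le> u y + dist x y" for x y
    proof (rule field_le_epsilon)
      fix \<epsilon> :: real assume \<epsilon>: "0 < \<epsilon>"
      show "u x \<le> u y + dist x y + \<epsilon>"
      proof (cases "u y + \<epsilon> \<le> R")
        case True
        then obtain k z where kz: "k \<le> R" "z \<in> E k" "real k + dist y z < u y + \<epsilon>"
          using u_cases[of y "u y + \<epsilon>"] \<epsilon> by auto
        then have "u x \<le> real k + dist x z" by (intro u_le) (auto simp: U_def)
        then show ?thesis using kz dist_triangle[of x z y] by linarith
      next
        case False
        then show ?thesis using uR[of x] zero_le_dist[of x y] by linarith
      qed
    qed
    have uj: "u (s *\<^sub>R \<iota> (a \<otimes> h)) \<le> u (s *\<^sub>R \<iota> h) + 1"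
      if "0 \<le> s" "h \<in> carrier G" "a \<in> S \<union> (\<lambda>s. inv s) ` S" for s h a
    proof (rule field_le_epsilon)
      fix \<epsilon> :: real assume \<epsilon>: "0 < \<epsilon>"
      show "u (s *\<^sub>R \<iota> (a \<otimes> h)) \<le> u (s *\<^sub>R \<iota> h) + 1 + \<epsilon>"
      proof (cases "u (s *\<^sub>R \<iota> h) + \<epsilon> \<le> R")
        case True
        then obtain k z where kz: "k \<le> R" "z \<in> E k" "real k + dist (s *\<^sub>R \<iota> h) z < u (s *\<^sub>R \<iota> h) + \<epsilon>"
          using u_cases[of "s *\<^sub>R \<iota> h" "u (s *\<^sub>R \<iota> h) + \<epsilon>"] \<epsilon> by auto
        then have dR: "real k + dist (s *\<^sub>R \<iota> h) z < R" using True by linarith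
        \<comment> \<open>As \<open>k\<close> and \<open>R\<close> are integers,
          \<open>k < R\<close> gives \<open>Suc k \<le> R\<close>: the translate lies in a set that
          still counts for \<open>u\<close>, at distance 0.\<close>
        then have dR': "dist (s *\<^sub>R \<iota> h) z < R" "Suc k \<le> R"
          using zero_le_dist[of "s *\<^sub>R \<iota> h" z] by linarith+
        have "real (Suc k) + 0 \<in> U (s *\<^sub>R \<iota> (a \<otimes> h))"
          using jump[OF kz(1,2) that(1,2) dR'(1) that(3)] dR'(2) unfolding U_def
          by (intro UnI1 CollectI exI[of _ "Suc k"] exI[of _ "s *\<^sub>R \<iota> (a \<otimes> h)"]) simp
        then have "u (s *\<^sub>R \<iota> (a \<otimes> h)) \<le> real (Suc k) + 0" by (rule u_le)
        moreover have "real (Suc k) = real k + 1" by simp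
        ultimately show ?thesis using kz(3) zero_le_dist[of "s *\<^sub>R \<iota> h" z] by linarith
      next
        case False
        then show ?thesis using uR[of "s *\<^sub>R \<iota> (a \<otimes> h)"] by linarith
      qed
    qed
    have pts: "t *\<^sub>R \<iota> g \<in> X" "t' *\<^sub>R \<iota> h \<in> X" using t_pos t' g h by (auto intro: cone_point)
    have "\<bar>u (t *\<^sub>R \<iota> g) - u (t' *\<^sub>R \<iota> h)\<bar> \<le> mdist W (t *\<^sub>R \<iota> g) (t' *\<^sub>R \<iota> h)"
      by (rule W_lower[OF lip _ pts]) (auto intro!: uj)
    moreover have "u (t *\<^sub>R \<iota> g) \<le> 0"
    proof -
      have "t *\<^sub>R \<iota> g \<in> E 0" using t_pos g \<rho>_self[of g]
        by (auto simp: E_def intro!: exI[of _ t] exI[of _ g])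
      then have "real 0 + dist (t *\<^sub>R \<iota> g) (t *\<^sub>R \<iota> g) \<in> U (t *\<^sub>R \<iota> g)" unfolding U_def by blast
      from u_le[OF this] show ?thesis by simp
    qed
    ultimately have "u (t' *\<^sub>R \<iota> h) < R" using less by linarith
    then obtain k z where kz: "k \<le> R" "z \<in> E k" "real k + dist (t' *\<^sub>R \<iota> h) z < R"
      using u_cases by blast
    then obtain b where b: "b \<in> word_ball S k" "\<rho> h (b \<otimes> g) \<le> (real k + 1) * e"
      using near[OF kz(1,2) t' h] by auto
    have "(real k + 1) * e \<le> (real R + 1) * e" using kz(1) e by (intro mult_right_mono) auto
    also have "\<dots> = \<eta>" by (simp add: e_def add_nonneg_eq_0_iff)
    finally show ?thesis using b word_ball_mono[OF kz(1)] by (meson order_trans subsetD)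
  qed
  then show ?thesis by blast
qed

end

section \<open>Property A\<close>

lemma C0_measurable:
  assumes "\<mu> \<in> Prob T" "\<phi> \<in> C0 T"
  shows "\<phi> \<in> borel_measurable \<mu>"
proof (rule borel_measurableI)
  fix U :: "real set" assume "open U"
  then have "openin T {x \<in> topspace T. \<phi> x \<in> U}"
    using assms(2) by (intro openin_continuous_map_preimage[where Y=euclideanreal]) (auto simp: C0_def)
  then have "{x \<in> topspace T. \<phi> x \<in> U} \<in> sets \<mu>" using assms(1) by (auto simp: Prob_def)
  moreover have "\<phi> -` U \<inter> space \<mu> = {x \<in> topspace T. \<phi> x \<in> U}" using assms(1) by (auto simp: Prob_def)
  ultimately show "\<phi> -` U \<inter> space \<mu> \<in> sets \<mu>" by simp
qed

lemma
  assumes \<mu>: "\<mu> \<in> Prob T" and \<phi>: "\<phi> \<in> C0 T" and le: "\<And>x. x \<in> topspace T \<Longrightarrow> \<bar>\<phi> x\<bar> \<le> c"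
  shows C0_integrable: "integrable \<mu> \<phi>" and C0_integral_bound: "\<bar>\<integral>x. \<phi> x \<partial>\<mu>\<bar> \<le> c"
proof -
  interpret prob_space \<mu> using \<mu> by (simp add: Prob_def)
  have sp: "space \<mu> = topspace T" using \<mu> by (simp add: Prob_def)
  show int: "integrable \<mu> \<phi>"
    using C0_measurable[OF \<mu> \<phi>] le sp by (intro integrable_const_bound[of _ c]) auto
  have "(\<integral>x. \<phi> x \<partial>\<mu>) \<le> c" using int le sp by (intro integral_le_const) (auto simp: abs_le_iff)
  moreover have "- c \<le> (\<integral>x. \<phi> x \<partial>\<mu>)" 
    using int le sp by (intro integral_ge_const) (auto simp: abs_le_iff minus_le_iff)
  ultimately show "\<bar>\<integral>x. \<phi> x \<partial>\<mu>\<bar> \<le> c" by (simp add: abs_le_iff minus_le_iff)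
qed

text \<open>The bound 2 makes the real suprema, here and in \<open>property_A\<close>, range over
  bounded sets, so that they really are upper bounds.\<close>

lemma norm_dist_le_2: "\<lbrakk>\<mu> \<in> Prob T; \<nu> \<in> Prob T\<rbrakk> \<Longrightarrow> norm_dist T \<mu> \<nu> \<le> 2"
  and norm_dist_upper: "\<lbrakk>\<mu> \<in> Prob T; \<nu> \<in> Prob T; \<phi> \<in> C0 T; \<And>x. x \<in> topspace T \<Longrightarrow> \<bar>\<phi> x\<bar> \<le> 1\<rbrakk>
    \<Longrightarrow> \<bar>(\<integral>x. \<phi> x \<partial>\<mu>) - (\<integral>x. \<phi> x \<partial>\<nu>)\<bar> \<le> norm_dist T \<mu> \<nu>"
proof -
  let ?Q = "{\<phi> \<in> C0 T. \<forall>x\<in>topspace T. \<bar>\<phi> x\<bar> \<le> 1}"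
  have le2: "\<bar>(\<integral>x. \<phi> x \<partial>\<mu>) - (\<integral>x. \<phi> x \<partial>\<nu>)\<bar> \<le> 2"
    if "\<mu> \<in> Prob T" "\<nu> \<in> Prob T" "\<phi> \<in> ?Q" for \<phi>
    using C0_integral_bound[OF that(1), of \<phi> 1] C0_integral_bound[OF that(2), of \<phi> 1] that(3) by auto
  have "(\<lambda>_. 0) \<in> ?Q" by (auto simp: C0_def intro!: exI[of _ "{}"])
  then have ne: "?Q \<noteq> {}" by blast
  show "norm_dist T \<mu> \<nu> \<le> 2" if "\<mu> \<in> Prob T" "\<nu> \<in> Prob T"
    unfolding norm_dist_def using le2[OF that] ne by (intro cSUP_least)
  show "\<bar>(\<integral>x. \<phi> x \<partial>\<mu>) - (\<integral>x. \<phi> x \<partial>\<nu>)\<bar> \<le> norm_dist T \<mu> \<nu>"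
    if "\<mu> \<in> Prob T" "\<nu> \<in> Prob T" "\<phi> \<in> C0 T" "\<And>x. x \<in> topspace T \<Longrightarrow> \<bar>\<phi> x\<bar> \<le> 1"
    unfolding norm_dist_def using le2[OF that(1,2)] that by (intro cSUP_upper bdd_aboveI2[of _ _ 2]) auto
qed

lemma
  assumes f: "continuous_map Y (weak_star_topology T) f"
  shows weak_star_Prob: "x \<in> topspace Y \<Longrightarrow> f x \<in> Prob T"
    and weak_star_continuous_integral:
      "\<phi> \<in> C0 T \<Longrightarrow> continuous_map Y euclideanreal (\<lambda>x. \<integral>z. \<phi> z \<partial>f x)"
proof -
  have "topspace (weak_star_topology T) \<subseteq> Prob T"
    unfolding weak_star_topology_def topology_generated_by_topspace by blast
  then show P: "f x \<in> Prob T" if "x \<in> topspace Y" for x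
    using continuous_map_image_subset_topspace[OF f] that by blast
  assume \<phi>: "\<phi> \<in> C0 T"
  show "continuous_map Y euclideanreal (\<lambda>x. \<integral>z. \<phi> z \<partial>f x)"
    unfolding continuous_map
  proof (intro conjI allI impI)
    fix U :: "real set" assume "openin euclideanreal U"
    then have "openin (weak_star_topology T) {\<mu> \<in> Prob T. (\<integral>z. \<phi> z \<partial>\<mu>) \<in> U}"
      using \<phi> unfolding weak_star_topology_def by (intro topology_generated_by_Basis) auto
    then have "openin Y {x \<in> topspace Y. f x \<in> {\<mu> \<in> Prob T. (\<integral>z. \<phi> z \<partial>\<mu>) \<in> U}}"
      by (rule openin_continuous_map_preimage[OF f])
    moreover have "{x \<in> topspace Y. f x \<in> {\<mu> \<in> Prob T. (\<integral>z. \<phi> z \<partial>\<mu>) \<in> U}}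
        = {x \<in> topspace Y. (\<integral>z. \<phi> z \<partial>f x) \<in> U}" using P by blast
    ultimately show "openin Y {x \<in> topspace Y. (\<integral>z. \<phi> z \<partial>f x) \<in> U}" by simp
  qed simp
qed

lemma property_A_obtain:
  assumes A: "property_A m" and \<epsilon>: "0 < \<epsilon>" and s: "0 < s"
  obtains f r where "continuous_map (mtopology_of m) (weak_star_topology (mtopology_of m)) f"
    "\<And>x. x \<in> mspace m \<Longrightarrow> AE z in f x. z \<in> mspace m \<and> mdist m x z < r"
    "\<And>x y. \<lbrakk>x \<in> mspace m; y \<in> mspace m; mdist m x y < s\<rbrakk> \<Longrightarrow> norm_dist (mtopology_of m) (f x) (f y) \<le> \<epsilon>"
proof -
  let ?T = "mtopology_of m"
  obtain f where "\<forall>n. continuous_map ?T (weak_star_topology ?T) (f n)"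
      and "\<forall>n. \<exists>r. \<forall>x\<in>mspace m. emeasure (f n x) (mspace m - mball_of m x r) = 0"
      and "\<forall>s>0. (\<lambda>n. SUP (x, y)\<in>{(x, y). x \<in> mspace m \<and> y \<in> mspace m \<and> mdist m x y < s}.
          norm_dist ?T (f n x) (f n y)) \<longlonglongrightarrow> 0"
    using A unfolding property_A_def by (elim exE conjE) (rule that)
  then have f: "\<And>n. continuous_map ?T (weak_star_topology ?T) (f n)"
      "\<And>n. \<exists>r. \<forall>x\<in>mspace m. emeasure (f n x) (mspace m - mball_of m x r) = 0"
      "(\<lambda>n. SUP (x, y)\<in>{(x, y). x \<in> mspace m \<and> y \<in> mspace m \<and> mdist m x y < s}.
          norm_dist ?T (f n x) (f n y)) \<longlonglongrightarrow> 0"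
    using s by simp_all
  have P: "f n x \<in> Prob ?T" if "x \<in> mspace m" for n x
    using weak_star_Prob[OF f(1)] that by simp
  obtain n where n: "(SUP (x, y)\<in>{(x, y). x \<in> mspace m \<and> y \<in> mspace m \<and> mdist m x y < s}.
          norm_dist ?T (f n x) (f n y)) < \<epsilon>"
    using order_tendstoD(2)[OF f(3) \<epsilon>] by (auto simp: eventually_sequentially)
  obtain r where r: "\<And>x. x \<in> mspace m \<Longrightarrow> emeasure (f n x) (mspace m - mball_of m x r) = 0"
    using f(2) by blast
  show thesis
  proof (rule that[OF f(1)[of n]])
    fix x y assume xy: "x \<in> mspace m" "y \<in> mspace m" "mdist m x y < s"
    have "(case (x, y) of (x, y) \<Rightarrow> norm_dist ?T (f n x) (f n y))
        \<le> (SUP (x, y)\<in>{(x, y). x \<in> mspace m \<and> y \<in> mspace m \<and> mdist m x y < s}.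
          norm_dist ?T (f n x) (f n y))"
      using xy norm_dist_le_2[OF P P] by (intro cSUP_upper bdd_aboveI2[of _ _ 2]) auto
    then show "norm_dist ?T (f n x) (f n y) \<le> \<epsilon>" using n by simp
  next
    fix x assume x: "x \<in> mspace m"
    interpret Metric_space "mspace m" "mdist m" by simp
    \<comment> \<open>A vanishing \<open>emeasure\<close> is informative only for a measurable set;
      the ball is open, hence Borel.\<close>
    have "openin ?T (mball_of m x r)" by (simp add: mtopology_of_def mball_of_def)
    then have "mball_of m x r \<in> sets (f n x)" using P[OF x, of n] by (auto simp: Prob_def)
    moreover have sp: "space (f n x) = mspace m" using P[OF x, of n] by (simp add: Prob_def)
    ultimately have "mspace m - mball_of m x r \<in> null_sets (f n x)"
      using r[OF x] sets.compl_sets by (force simp: null_sets_def)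
    then have "AE z in f n x. z \<notin> mspace m - mball_of m x r" by (rule AE_not_in)
    moreover have "AE z in f n x. z \<in> mspace m" using AE_space[of "f n x"] by (simp add: sp)
    ultimately show "AE z in f n x. z \<in> mspace m \<and> mdist m x z < r"
      by eventually_elim (auto simp: mball_of_def)
  qed
qed

section \<open>Bump functions on the cone\<close>

text \<open>At most one summand is nonzero.\<close>

lemma sum_disjoint_support:
  fixes f :: "'i \<Rightarrow> real"
  assumes "finite C" "\<And>i. i \<in> C \<Longrightarrow> 0 \<le> f i \<and> f i \<le> 1"
    and dis: "\<And>i j. \<lbrakk>i \<in> C; j \<in> C; i \<noteq> j; f i \<noteq> 0\<rbrakk> \<Longrightarrow> f j = 0"
  shows "\<bar>sum f C\<bar> \<le> 1"
proof (cases "\<exists>i\<in>C. f i \<noteq> 0")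
  case True
  then obtain i where i: "i \<in> C" "f i \<noteq> 0" by blast
  have "sum f C = f i + sum f (C - {i})" using assms(1) i(1) by (rule sum.remove)
  also have "sum f (C - {i}) = 0" using dis i by (intro sum.neutral) auto
  finally show ?thesis using assms(2)[OF i(1)] by simp
next
  case False
  then have "sum f C = 0" by (intro sum.neutral) auto
  then show ?thesis by simp
qed

text \<open>The part of the cone at radius close to \<open>t\<close>. Separation by
  \<open>4 * \<delta>\<close> makes bumps of radius \<open>2 * \<delta>\<close> disjoint, and
  \<open>R + 2 \<le> t\<close> keeps their supports away from the tip.\<close>

locale warped_window = warped_group G \<iota> S W
  for G :: "('g, 'm) monoid_scheme" (structure) and \<iota> :: "'g \<Rightarrow> 'e::euclidean_space" and S W +
  fixes R t \<delta> :: real and D :: "'g set"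
  assumes D: "finite D" "D \<subseteq> carrier G"
    and \<delta>: "0 < \<delta>" and R: "0 \<le> R" and t: "R + 2 \<le> t"
    and separated: "\<And>a b. \<lbrakk>a \<in> D; b \<in> D; a \<noteq> b\<rbrakk> \<Longrightarrow> 4 * \<delta> \<le> \<rho> (inv a) (inv b)"
begin

definition bump :: "real \<Rightarrow> real" where "bump v = max 0 (min 1 (2 - v / \<delta>))"

definition annulus :: "real \<Rightarrow> real" where "annulus v = max 0 (min 1 (R + 1 - \<bar>v - t\<bar>))"

text \<open>A bump about the direction \<open>inv c \<otimes> g\<close>: it is 1 within \<delta> of
  this direction at radii within \<open>R\<close> of \<open>t\<close>, and 0 from
  \<open>2 * \<delta>\<close> or \<open>R + 1\<close> on. At the tip, where the direction is
  meaningless, the annulus factor vanishes.\<close>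

definition \<Psi> :: "'g \<Rightarrow> 'g \<Rightarrow> 'e \<Rightarrow> real" where
  "\<Psi> c g z = annulus (norm z) * bump (\<rho> (inv_into (carrier G) \<iota> (z /\<^sub>R norm z)) (inv c \<otimes> g))"

lemma \<Psi>_cone_point:
  assumes "0 \<le> s" "h \<in> carrier G"
  shows "\<Psi> c g (s *\<^sub>R \<iota> h) = annulus s * bump (\<rho> h (inv c \<otimes> g))"
proof (cases "s = 0")
  case True
  then have "annulus s = 0" using R t by (simp add: annulus_def)
  then show ?thesis using assms by (simp add: \<Psi>_def)
qed (use assms inj in \<open>simp add: \<Psi>_def\<close>)

lemma \<Psi>_range: "0 \<le> \<Psi> c g z" "\<Psi> c g z \<le> 1"
  by (auto simp: \<Psi>_def annulus_def bump_def intro!: mult_nonneg_nonneg mult_le_one)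

text \<open>A common point of the supports has \<rho>-distance below \<open>2 * \<delta>\<close>
  from both centres; cancelling \<open>g\<close> by right invariance contradicts the
  separation.\<close>

lemma \<Psi>_disjoint:
  assumes ab: "a \<in> D" "b \<in> D" "a \<noteq> b" and g: "g \<in> carrier G" and z: "z \<in> X" and nz: "\<Psi> a g z \<noteq> 0"
  shows "\<Psi> b g z = 0"
proof (rule ccontr)
  assume nz': "\<Psi> b g z \<noteq> 0"
  obtain s h where h: "0 \<le> s" "h \<in> carrier G" "z = s *\<^sub>R \<iota> h" using z by (rule cone_pointE)
  have "bump (\<rho> h (inv a \<otimes> g)) \<noteq> 0" "bump (\<rho> h (inv b \<otimes> g)) \<noteq> 0"
    using nz nz' h by (auto simp: \<Psi>_cone_point)
  then have lt: "\<rho> h (inv a \<otimes> g) < 2 * \<delta>" "\<rho> h (inv b \<otimes> g) < 2 * \<delta>"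
    using \<delta> by (auto simp: bump_def max_def min_def field_simps split: if_splits)
  have "a \<in> carrier G" "b \<in> carrier G" using ab D by auto
  then have "\<rho> (inv a) (inv b) \<le> \<rho> h (inv a \<otimes> g) + \<rho> h (inv b \<otimes> g)"
    using \<rho>_triangle[of "inv a \<otimes> g" h "inv b \<otimes> g"] \<rho>_right[of "inv a" "inv b" g] g h(2)
    by (simp add: \<rho>_sym[of h "inv a \<otimes> g"])
  then show False using lt separated[OF ab] by linarith
qed

text \<open>The inverse in the centre turns a translation of \<open>g\<close> into a relabelling of
  the bumps.\<close>

lemma \<Psi>_translate:
  assumes "s \<in> carrier G" "g \<in> carrier G" "c \<in> carrier G"
  shows "\<Psi> c (s \<otimes> g) z = \<Psi> (inv s \<otimes> c) g z"
  using assms by (simp add: \<Psi>_def inv_mult_group m_assoc)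

text \<open>The profile \<open>bump\<close> has slope at most \<open>1 / \<delta>\<close>, and by
  left invariance the two centres are \<open>\<rho> g g'\<close> apart.\<close>

lemma \<Psi>_Lipschitz:
  assumes "c \<in> carrier G" "g \<in> carrier G" "g' \<in> carrier G" "z \<in> X"
  shows "\<bar>\<Psi> c g z - \<Psi> c g' z\<bar> \<le> \<rho> g g' / \<delta>"
proof -
  obtain s h where h: "0 \<le> s" "h \<in> carrier G" "z = s *\<^sub>R \<iota> h" using assms(4) by (rule cone_pointE)
  let ?a = "inv c \<otimes> g" and ?b = "inv c \<otimes> g'"
  have eq: "\<rho> ?a ?b = \<rho> g g'" using assms by (intro \<rho>_left) auto
  have "\<rho> h ?a \<le> \<rho> h ?b + \<rho> g g'" "\<rho> h ?b \<le> \<rho> h ?a + \<rho> g g'"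
    using \<rho>_triangle[of h ?b ?a] \<rho>_triangle[of h ?a ?b] eq assms h by (simp_all add: \<rho>_sym[of ?b ?a])
  then have "\<rho> h ?a / \<delta> \<le> \<rho> h ?b / \<delta> + \<rho> g g' / \<delta>" "\<rho> h ?b / \<delta> \<le> \<rho> h ?a / \<delta> + \<rho> g g' / \<delta>"
    using \<delta> by (simp_all add: field_simps)
  then have "\<bar>bump (\<rho> h ?a) - bump (\<rho> h ?b)\<bar> \<le> \<rho> g g' / \<delta>"
    unfolding bump_def by linarith
  moreover have "\<bar>annulus s\<bar> \<le> 1" by (simp add: annulus_def)
  ultimately have "\<bar>annulus s\<bar> * \<bar>bump (\<rho> h ?a) - bump (\<rho> h ?b)\<bar> \<le> 1 * (\<rho> g g' / \<delta>)"
    by (intro mult_mono) auto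
  then show ?thesis using h by (simp add: \<Psi>_cone_point abs_mult flip: right_diff_distrib)
qed

lemma \<Psi>_continuous:
  assumes "c \<in> carrier G" "g \<in> carrier G"
  shows "continuous_on X (\<Psi> c g)"
proof -
  let ?j = "inv_into (carrier G) \<iota>" and ?k = "inv c \<otimes> g"
  have \<rho>c: "continuous_on (\<iota> ` carrier G) (\<lambda>u. \<rho> (?j u) ?k)"
    unfolding continuous_on_iff
  proof (intro ballI allI impI)
    fix u and e :: real assume u: "u \<in> \<iota> ` carrier G" and e: "0 < e"
    obtain d where d: "0 < d" "\<And>x y. \<lbrakk>x \<in> carrier G; y \<in> carrier G; dist (\<iota> x) (\<iota> y) < d\<rbrakk> \<Longrightarrow> \<rho> x y < e"
      using \<rho>_uniform[OF e] by metis
    have "dist (\<rho> (?j v) ?k) (\<rho> (?j u) ?k) < e" if v: "v \<in> \<iota> ` carrier G" "dist v u < d" for v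
    proof -
      obtain x y where xy: "x \<in> carrier G" "y \<in> carrier G" "u = \<iota> x" "v = \<iota> y" using u v by blast
      have "\<rho> y x < e" using d(2) xy v(2) by blast
      then show ?thesis
        using \<rho>_triangle[of x y ?k] \<rho>_triangle[of y x ?k] \<rho>_sym[of x y] xy assms inj
        by (simp add: dist_real_def abs_less_iff)
    qed
    then show "\<exists>d>0. \<forall>v\<in>\<iota> ` carrier G. dist v u < d \<longrightarrow> dist (\<rho> (?j v) ?k) (\<rho> (?j u) ?k) < e"
      using d(1) by blast
  qed
  have "continuous_on {z \<in> X. 1 \<le> norm z} (\<Psi> c g)"
    unfolding \<Psi>_def annulus_def bump_def
  proof (intro continuous_intros continuous_on_compose2[OF \<rho>c])
    show "(\<lambda>z. z /\<^sub>R norm z) ` {z \<in> X. 1 \<le> norm z} \<subseteq> \<iota> ` carrier G"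
    proof (clarify)
      fix z assume "z \<in> X" "1 \<le> norm z"
      then show "z /\<^sub>R norm z \<in> \<iota> ` carrier G" by (elim cone_pointE) auto
    qed
  qed (use \<delta> in auto)
  \<comment> \<open>Normalising \<open>z\<close> is not continuous at the tip, so the function is
    glued to 0 along the unit sphere, where the annulus factor is already 0.\<close>
  then have "continuous_on X (\<lambda>z. if norm z \<le> 1 then 0 else \<Psi> c g z)"
    using R t by (intro continuous_on_cases_le continuous_intros) (auto simp: \<Psi>_def annulus_def)
  moreover have "(if norm z \<le> 1 then 0 else \<Psi> c g z) = \<Psi> c g z" for z
    using R t by (auto simp: \<Psi>_def annulus_def)
  ultimately show ?thesis by simp
qed

lemma \<Psi>_C0:
  assumes "C \<subseteq> D" "g \<in> carrier G"
  shows "(\<lambda>z. \<Sum>c\<in>C. \<Psi> c g z) \<in> C0 (top_of_set X)"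
proof -
  have "continuous_on X (\<lambda>z. \<Sum>c\<in>C. \<Psi> c g z)"
    using assms D by (intro continuous_on_sum \<Psi>_continuous) auto
  moreover have "\<exists>K. compactin (top_of_set X) K \<and> (\<forall>z\<in>X - K. \<bar>\<Sum>c\<in>C. \<Psi> c g z\<bar> < e)" if "0 < e" for e
  proof -
    \<comment> \<open>The truncated cone contains the supports of all bumps.\<close>
    let ?K = "(\<lambda>p. fst p *\<^sub>R snd p) ` ({0..t + R + 1} \<times> \<iota> ` carrier G)"
    have "compact ?K" using cpt by (intro compact_continuous_image compact_Times continuous_intros) auto
    moreover have "?K \<subseteq> X" by (auto intro: cone_point)
    moreover have "\<Psi> c g z = 0" if z: "z \<in> X - ?K" for c z
    proof -
      obtain s h where h: "0 \<le> s" "h \<in> carrier G" "z = s *\<^sub>R \<iota> h" using z by (blast elim: cone_pointE)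
      have "s \<notin> {0..t + R + 1}" using z h by force
      then have "annulus s = 0" using h by (simp add: annulus_def)
      then show ?thesis using h by (simp add: \<Psi>_cone_point)
    qed
    ultimately show ?thesis using that
      by (intro exI[of _ ?K]) (simp add: compactin_subtopology)
  qed
  ultimately show ?thesis by (simp add: C0_def)
qed

lemma \<Psi>_C0_single: "\<lbrakk>c \<in> D; g \<in> carrier G\<rbrakk> \<Longrightarrow> \<Psi> c g \<in> C0 (top_of_set X)"
  using \<Psi>_C0[of "{c}" g] by simp

lemma \<Psi>_sum_bound: "\<lbrakk>C \<subseteq> D; g \<in> carrier G; z \<in> X\<rbrakk> \<Longrightarrow> \<bar>\<Sum>c\<in>C. \<Psi> c g z\<bar> \<le> 1"
  using D(1) by (intro sum_disjoint_support) (auto intro: finite_subset \<Psi>_range \<Psi>_disjoint)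

end

section \<open>Almost invariant means from a single window\<close>

text \<open>\<open>p c g\<close> is the integral of the bump of \<open>c\<close> against the measure
  at the point over \<open>g\<close>, and \<open>\<mu> A\<close> is a right average, evaluated at 1,
  of its sum over \<open>A \<inter> B\<close>. Translating \<open>A\<close> and \<open>g\<close>
  together by \<open>s\<close> costs \<epsilon> since \<open>F\<close> varies little along
  generators; moving the evaluation point from \<open>s\<close> back to 1 costs another
  \<epsilon>.\<close>

lemma (in warped_window) almost_invariant_mean:
  assumes F: "continuous_map (top_of_set X) (weak_star_topology (top_of_set X)) F"
    and near: "\<And>s g. \<lbrakk>s \<in> S; g \<in> carrier G\<rbrakk> \<Longrightarrow>
      norm_dist (top_of_set X) (F (t *\<^sub>R \<iota> g)) (F (t *\<^sub>R \<iota> (s \<otimes> g))) \<le> \<epsilon>"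
    and conc: "\<And>g. g \<in> carrier G \<Longrightarrow> AE z in F (t *\<^sub>R \<iota> g). z \<in> X \<and>
      (\<exists>s h b. 0 \<le> s \<and> \<bar>s - t\<bar> \<le> R \<and> h \<in> carrier G \<and> z = s *\<^sub>R \<iota> h \<and> b \<in> B \<and> \<rho> h (inv b \<otimes> g) \<le> \<delta>)"
    and B: "B \<subseteq> D" "B \<subseteq> H" "\<And>s b. \<lbrakk>s \<in> S; b \<in> B\<rbrakk> \<Longrightarrow> s \<otimes> b \<in> D \<and> inv s \<otimes> b \<in> D"
    and H: "H \<subseteq> carrier G"
    and \<epsilon>: "0 < \<epsilon>"
  shows "\<exists>\<mu> :: 'g set \<Rightarrow> real. \<mu> H = 1 \<and> (\<forall>A\<subseteq>H. 0 \<le> \<mu> A) \<and>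
    (\<forall>A\<subseteq>H. \<forall>A'\<subseteq>H. A \<inter> A' = {} \<longrightarrow> \<mu> (A \<union> A') = \<mu> A + \<mu> A') \<and>
    (\<forall>s\<in>S. \<forall>A\<subseteq>H. \<bar>\<mu> (s <# A) - \<mu> A\<bar> \<le> 2 * \<epsilon>)"
proof -
  let ?T = "top_of_set X"
  \<comment> \<open>The base point of the bumps and that of the measure are separated, so that they
    can be moved one at a time.\<close>
  define I where "I = (\<lambda>c g g'. \<integral>z. \<Psi> c g z \<partial>F (t *\<^sub>R \<iota> g'))"
  define p where "p = (\<lambda>c g. I c g g)"
  have t0: "0 \<le> t" using R t by linarith
  have finB: "finite B" using B(1) D(1) by (rule finite_subset)
  have DG: "c \<in> carrier G" if "c \<in> D" for c using that D by blast
  have P: "F (t *\<^sub>R \<iota> g) \<in> Prob ?T" if "g \<in> carrier G" for g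
    using weak_star_Prob[OF F] cone_point[OF t0 that] by simp
  have int: "integrable (F (t *\<^sub>R \<iota> g')) (\<Psi> c g)" if "c \<in> D" "g \<in> carrier G" "g' \<in> carrier G" for c g g'
    using \<Psi>_C0_single[OF that(1,2)] \<Psi>_range
    by (intro C0_integrable[OF P[OF that(3)], of _ 1]) (auto simp: abs_le_iff intro: order_trans[of _ 0])
  have I_sum: "(\<Sum>c\<in>C. I c g g') = (\<integral>z. (\<Sum>c\<in>C. \<Psi> c g z) \<partial>F (t *\<^sub>R \<iota> g'))"
    if "C \<subseteq> D" "g \<in> carrier G" "g' \<in> carrier G" for C g g'
    unfolding I_def using that int by (subst Bochner_Integration.integral_sum) auto
  have p_range: "0 \<le> p c g \<and> \<bar>p c g\<bar> \<le> 1" if "c \<in> D" "g \<in> carrier G" for c g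
    unfolding p_def I_def using \<Psi>_range \<Psi>_C0_single[OF that]
    by (intro conjI integral_nonneg C0_integral_bound[OF P[OF that(2)]])
      (auto simp: abs_le_iff intro: order_trans[of _ 0])
  \<comment> \<open>Almost every point is within \<delta> of the centre of some bump from
    \<open>B\<close>. That bump is 1 there, and by disjointness all others vanish.\<close>
  have conc': "AE z in F (t *\<^sub>R \<iota> g). (\<Sum>c\<in>B. \<Psi> c g z) = 1 \<and> (\<forall>c\<in>D - B. \<Psi> c g z = 0)"
    if g: "g \<in> carrier G" for g
    using conc[OF g]
  proof eventually_elim
    case (elim z)
    then obtain s h b where z: "z \<in> X" "0 \<le> s" "\<bar>s - t\<bar> \<le> R" "h \<in> carrier G" "z = s *\<^sub>R \<iota> h"
      "b \<in> B" "\<rho> h (inv b \<otimes> g) \<le> \<delta>" by blast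
    have "\<rho> h (inv b \<otimes> g) / \<delta> \<le> 1" using z(7) \<delta> by simp
    then have b1: "\<Psi> b g z = 1"
      using z(3) unfolding z(5) \<Psi>_cone_point[OF z(2,4)] annulus_def bump_def by simp
    have z0: "\<Psi> c g z = 0" if "c \<in> D" "c \<noteq> b" for c
      using \<Psi>_disjoint[of b c g z] that B(1) z(1,6) g b1 by auto
    have "(\<Sum>c\<in>B. \<Psi> c g z) = \<Psi> b g z + (\<Sum>c\<in>B - {b}. \<Psi> c g z)"
      using finB z(6) by (rule sum.remove)
    also have "(\<Sum>c\<in>B - {b}. \<Psi> c g z) = 0" using z0 B(1) by (intro sum.neutral) auto
    finally show ?case using b1 z0 z(6) by auto
  qed
  have p_total: "(\<Sum>c\<in>B. p c g) = 1" if g: "g \<in> carrier G" for g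
  proof -
    interpret prob_space "F (t *\<^sub>R \<iota> g)" using P[OF g] by (simp add: Prob_def)
    have "(\<Sum>c\<in>B. p c g) = (\<integral>z. (\<Sum>c\<in>B. \<Psi> c g z) \<partial>F (t *\<^sub>R \<iota> g))"
      unfolding p_def using I_sum[OF B(1) g g] .
    also have "\<dots> = (\<integral>z. 1 \<partial>F (t *\<^sub>R \<iota> g))"
      using conc'[OF g] C0_measurable[OF P[OF g] \<Psi>_C0[OF B(1) g]] by (intro integral_cong_AE) auto
    finally show ?thesis by (simp add: prob_space)
  qed
  have p_zero: "p c g = 0" if "c \<in> D - B" "g \<in> carrier G" for c g
    unfolding p_def I_def using conc'[OF that(2)] that(1)
    by (intro integral_eq_zero_AE) (auto elim: eventually_mono)
  \<comment> \<open>A sum of disjoint bumps is bounded by 1, so one norm distance controls the whole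
    sum, with no factor \<open>card C\<close>.\<close>
  have I_close: "\<bar>(\<Sum>c\<in>C. I c g (s \<otimes> g)) - (\<Sum>c\<in>C. I c g g)\<bar> \<le> \<epsilon>"
    if "C \<subseteq> D" "s \<in> S" "g \<in> carrier G" for C s g
  proof -
    have sg: "s \<otimes> g \<in> carrier G" using that S by auto
    have "\<bar>(\<Sum>c\<in>C. I c g g) - (\<Sum>c\<in>C. I c g (s \<otimes> g))\<bar> \<le> norm_dist ?T (F (t *\<^sub>R \<iota> g)) (F (t *\<^sub>R \<iota> (s \<otimes> g)))"
      unfolding I_sum[OF that(1,3,3)] I_sum[OF that(1,3) sg]
      using \<Psi>_sum_bound[OF that(1,3)] by (intro norm_dist_upper P that sg \<Psi>_C0) auto
    then show ?thesis using near[OF that(2,3)] by (simp add: abs_minus_commute)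
  qed
  \<comment> \<open>Half of \<open>e\<close> pays for moving the bumps, by the Lipschitz bound, and
    half for moving the measure, by weak-* continuity.\<close>
  have p_unif: "\<exists>d>0. \<forall>x\<in>carrier G. \<forall>y\<in>carrier G. \<rho> x y < d \<longrightarrow> dist (p c x) (p c y) < e"
    if c: "c \<in> D" and "0 < e" for c e
  proof (rule \<iota>_uniform_imp_\<rho>[OF _ \<open>0 < e\<close>])
    let ?j = "inv_into (carrier G) \<iota>"
    show "continuous_on (\<iota> ` carrier G) (p c \<circ> ?j)"
      unfolding continuous_on_iff
    proof (intro ballI allI impI)
      fix u and e :: real assume u: "u \<in> \<iota> ` carrier G" and e: "0 < e"
      obtain g where g: "g \<in> carrier G" "u = \<iota> g" using u by blast
      have "0 < \<delta> * (e / 2)" using \<delta> e by simp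
      then obtain d1 where d1: "0 < d1"
          "\<And>x y. \<lbrakk>x \<in> carrier G; y \<in> carrier G; dist (\<iota> x) (\<iota> y) < d1\<rbrakk> \<Longrightarrow> \<rho> x y < \<delta> * (e / 2)"
        using \<rho>_uniform by metis
      have "continuous_on X (\<lambda>x. \<integral>z. \<Psi> c g z \<partial>F x)"
        using weak_star_continuous_integral[OF F \<Psi>_C0_single[OF c g(1)]] by simp
      then have "continuous_on (\<iota> ` carrier G) (\<lambda>u. \<integral>z. \<Psi> c g z \<partial>F (t *\<^sub>R u))"
        by (rule continuous_on_compose2) (use t0 in \<open>auto intro!: continuous_intros cone_point\<close>)
      then obtain d2 where d2: "0 < d2" "\<And>v. \<lbrakk>v \<in> \<iota> ` carrier G; dist v u < d2\<rbrakk>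
          \<Longrightarrow> dist (\<integral>z. \<Psi> c g z \<partial>F (t *\<^sub>R v)) (\<integral>z. \<Psi> c g z \<partial>F (t *\<^sub>R u)) < e / 2"
        unfolding continuous_on_iff using u half_gt_zero[OF e] by metis
      have "dist (p c h) (p c g) < e" if h: "h \<in> carrier G" "dist (\<iota> h) (\<iota> g) < min d1 d2" for h
      proof -
        interpret prob_space "F (t *\<^sub>R \<iota> h)" using P[OF h(1)] by (simp add: Prob_def)
        have sp: "space (F (t *\<^sub>R \<iota> h)) = X" using P[OF h(1)] by (simp add: Prob_def)
        have "\<rho> h g / \<delta> \<le> e / 2" using d1(2)[OF h(1) g(1)] h(2) \<delta> by (simp add: field_simps)
        then have bd: "\<bar>\<Psi> c h z - \<Psi> c g z\<bar> \<le> e / 2" if "z \<in> X" for z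
          using \<Psi>_Lipschitz[OF DG[OF c] h(1) g(1) that] by linarith
        have bd': "\<Psi> c h z - \<Psi> c g z \<le> e / 2" "- (e / 2) \<le> \<Psi> c h z - \<Psi> c g z" if "z \<in> X" for z
          using bd[OF that] by linarith+
        have ii: "integrable (F (t *\<^sub>R \<iota> h)) (\<lambda>z. \<Psi> c h z - \<Psi> c g z)"
          using int[OF c] h g by simp
        have eq: "I c h h - I c g h = (\<integral>z. \<Psi> c h z - \<Psi> c g z \<partial>F (t *\<^sub>R \<iota> h))"
          unfolding I_def using int[OF c] h g by (subst Bochner_Integration.integral_diff) auto
        have "(\<integral>z. \<Psi> c h z - \<Psi> c g z \<partial>F (t *\<^sub>R \<iota> h)) \<le> e / 2"
          using ii by (intro integral_le_const AE_I2) (simp_all only: sp bd')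
        moreover have "- (e / 2) \<le> (\<integral>z. \<Psi> c h z - \<Psi> c g z \<partial>F (t *\<^sub>R \<iota> h))"
          using ii by (intro integral_ge_const AE_I2) (simp_all only: sp bd')
        moreover have "\<bar>I c g h - I c g g\<bar> < e / 2"
          using d2(2)[of "\<iota> h"] h g by (simp add: I_def dist_real_def)
        ultimately show ?thesis unfolding p_def dist_real_def using eq by linarith
      qed
      then show "\<exists>d>0. \<forall>v\<in>\<iota> ` carrier G. dist v u < d \<longrightarrow> dist ((p c \<circ> ?j) v) ((p c \<circ> ?j) u) < e"
        using d1(1) d2(1) g inj by (intro exI[of _ "min d1 d2"]) auto
    qed
  qed
  \<comment> \<open>At most \<open>card B\<close> oscillations are added up later; the 1 avoids a
    zero denominator.\<close>
  define e where "e = \<epsilon> / (card B + 1)"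
  have e: "0 < e" using \<epsilon> by (simp add: e_def)
  have "\<exists>M. right_mean G M \<and> (\<forall>c\<in>B. \<forall>x\<in>carrier G. \<forall>y\<in>carrier G. \<bar>M (p c) x - M (p c) y\<bar> \<le> e)"
  proof (rule right_mean_oscillation_family[of \<rho>, OF \<rho>_right \<rho>_totally_bounded finB _ _ e])
    fix c d assume "c \<in> B" "(0::real) < d"
    then show "\<exists>d'>0. \<forall>x\<in>carrier G. \<forall>y\<in>carrier G. \<rho> x y < d' \<longrightarrow> \<bar>p c x - p c y\<bar> \<le> d"
      using p_unif[of c d] B(1) by (force simp: dist_real_def)
  qed (use p_range B(1) in auto)
  then obtain M where M: "right_mean G M"
    and osc: "\<And>c x y. \<lbrakk>c \<in> B; x \<in> carrier G; y \<in> carrier G\<rbrakk> \<Longrightarrow> \<bar>M (p c) x - M (p c) y\<bar> \<le> e" by blast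
  define v where "v = (\<lambda>A g. \<Sum>c\<in>A \<inter> B. p c g)"
  define \<mu> where "\<mu> = (\<lambda>A. M (v A) \<one>)"
  have Mv: "M (v A) x = (\<Sum>c\<in>A \<inter> B. M (p c) x)" for A x
    unfolding v_def using finB by (intro right_mean_sum[OF M]) auto
  \<comment> \<open>Since \<open>p c\<close> vanishes for \<open>c\<close> in \<open>D - B\<close>,
    the index set may be enlarged within \<open>D\<close>. This makes it possible to match index
    sets under translation.\<close>
  have v_eq: "v A g = (\<Sum>c\<in>A \<inter> C. p c g)" if "B \<subseteq> C" "C \<subseteq> D" "g \<in> carrier G" for A C g
    unfolding v_def using that p_zero finite_subset[OF that(2) D(1)]
    by (intro sum.mono_neutral_left) auto
  have shift: "\<bar>v (s <# A) (s \<otimes> g) - v A g\<bar> \<le> \<epsilon>" if s: "s \<in> S" and A: "A \<subseteq> H" and g: "g \<in> carrier G" for s A g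
  proof -
    have sG: "s \<in> carrier G" using s S by blast
    have AG: "A \<subseteq> carrier G" using A H by blast
    have BG: "B \<subseteq> carrier G" using B(1) D(2) by blast
    \<comment> \<open>Left translation by \<open>s\<close> maps \<open>?C'\<close> onto
      \<open>?C\<close>, hence \<open>A \<inter> ?C'\<close> onto the corresponding part of the
      coset of \<open>A\<close>.\<close>
    let ?C = "B \<union> (\<lambda>b. s \<otimes> b) ` B" and ?C' = "B \<union> (\<lambda>b. inv s \<otimes> b) ` B"
    have C: "?C \<subseteq> D" "?C' \<subseteq> D" using B s by auto
    have "v (s <# A) (s \<otimes> g) = (\<Sum>c\<in>(s <# A) \<inter> ?C. I c (s \<otimes> g) (s \<otimes> g))"
      using v_eq[OF _ C(1), of "s \<otimes> g"] sG g by (simp add: p_def)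
    also have "\<dots> = (\<Sum>c\<in>A \<inter> ?C'. I c g (s \<otimes> g))"
    proof (rule sum.reindex_bij_witness[of _ "\<lambda>c. s \<otimes> c" "\<lambda>c. inv s \<otimes> c"])
      fix c assume c: "c \<in> (s <# A) \<inter> ?C"
      then have cG: "c \<in> carrier G" using C(1) DG by blast
      show "s \<otimes> (inv s \<otimes> c) = c" using cG sG by (simp add: m_assoc[symmetric])
      obtain a where a: "a \<in> A" "c = s \<otimes> a" using c by (auto simp: l_coset_def)
      have "inv s \<otimes> c \<in> A" using a AG sG by (auto simp: m_assoc[symmetric] subset_iff)
      moreover have "inv s \<otimes> c \<in> ?C'"
        using c sG BG by (auto simp: m_assoc[symmetric] subset_iff)
      ultimately show "inv s \<otimes> c \<in> A \<inter> ?C'" by blast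
      show "I (inv s \<otimes> c) g (s \<otimes> g) = I c (s \<otimes> g) (s \<otimes> g)"
        unfolding I_def \<Psi>_translate[OF sG g cG, THEN ext] ..
    next
      fix c assume c: "c \<in> A \<inter> ?C'"
      then have cG: "c \<in> carrier G" using AG by blast
      show "inv s \<otimes> (s \<otimes> c) = c" using cG sG by (simp add: m_assoc[symmetric])
      have "s \<otimes> c \<in> s <# A" using c by (auto simp: l_coset_def)
      moreover have "s \<otimes> c \<in> ?C"
        using c sG BG by (auto simp: m_assoc[symmetric] subset_iff)
      ultimately show "s \<otimes> c \<in> (s <# A) \<inter> ?C" by blast
    qed
    finally have "v (s <# A) (s \<otimes> g) = (\<Sum>c\<in>A \<inter> ?C'. I c g (s \<otimes> g))" .
    moreover have "v A g = (\<Sum>c\<in>A \<inter> ?C'. I c g g)"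
      using v_eq[OF _ C(2) g] by (simp add: p_def)
    ultimately show ?thesis using I_close[of "A \<inter> ?C'" s g] C(2) s g by auto
  qed
  have "\<mu> H = M (\<lambda>_. 1) \<one>"
    unfolding \<mu>_def using p_total B(2) by (intro right_mean_cong[OF M]) (auto simp: v_def Int_absorb1)
  then have "\<mu> H = 1" by (simp add: right_mean_const[OF M])
  moreover have "0 \<le> \<mu> A" for A
  proof -
    have "M (\<lambda>_. 0) \<one> \<le> \<mu> A" unfolding \<mu>_def v_def using p_range B(1)
      by (intro right_mean_mono[OF M] sum_nonneg) auto
    then show ?thesis by (simp add: right_mean_const[OF M])
  qed
  moreover have "\<mu> (A \<union> A') = \<mu> A + \<mu> A'" if "A \<inter> A' = {}" for A A'
    unfolding \<mu>_def Mv Int_Un_distrib2 using finB that by (intro sum.union_disjoint) auto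
  moreover have "\<bar>\<mu> (s <# A) - \<mu> A\<bar> \<le> 2 * \<epsilon>" if s: "s \<in> S" and A: "A \<subseteq> H" for s A
  proof -
    have sG: "s \<in> carrier G" using s S by blast
    have "\<bar>M (\<lambda>g. v (s <# A) (s \<otimes> g)) \<one> - M (v A) \<one>\<bar> \<le> \<epsilon>"
      using shift[OF s A] by (intro right_mean_close[OF M]) auto
    moreover have "M (\<lambda>g. v (s <# A) (s \<otimes> g)) \<one> = M (v (s <# A)) s"
      using right_mean_left_translate[OF M sG one_closed, of "v (s <# A)"] sG by simp
    moreover have "\<bar>M (v (s <# A)) s - M (v (s <# A)) \<one>\<bar> \<le> \<epsilon>"
    proof -
      have "\<bar>M (v (s <# A)) s - M (v (s <# A)) \<one>\<bar> \<le> (\<Sum>c\<in>(s <# A) \<inter> B. \<bar>M (p c) s - M (p c) \<one>\<bar>)"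
        unfolding Mv sum_subtractf[symmetric] by (rule sum_abs)
      also have "\<dots> \<le> (\<Sum>c\<in>(s <# A) \<inter> B. e)" using osc sG by (intro sum_mono) auto
      also have "\<dots> \<le> (\<Sum>c\<in>B. e)" using finB e by (intro sum_mono2) auto
      also have "\<dots> \<le> \<epsilon>" using \<epsilon> by (simp add: e_def field_simps)
      finally show ?thesis .
    qed
    ultimately show ?thesis unfolding \<mu>_def by linarith
  qed
  ultimately show ?thesis by (intro exI[of _ \<mu>]) auto
qed

section \<open>From the Lie group to amenability\<close>

text \<open>A smooth embedding is a homeomorphism onto its image, so continuity of the
  multiplication and compactness both pass to the image.\<close>

lemma embedded_group_of_Lie_group:
  fixes \<iota> :: "'g \<Rightarrow> 'a::euclidean_space"
  assumes G: "Lie_group V G T \<A>" and "compact_space T"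
    and emb: "smooth_embedding V T \<A> \<iota>" and sph: "\<iota> ` carrier G \<subseteq> sphere 0 1"
  shows "embedded_group G \<iota>"
proof -
  interpret group G using G by (simp add: Lie_group_def)
  have top: "topspace T = carrier G" using G by (simp add: Lie_group_def)
  have mult: "continuous_map (prod_topology T T) T (\<lambda>(x, y). x \<otimes>\<^bsub>G\<^esub> y)"
    using G by (simp add: Lie_group_def smooth_map_def)
  let ?K = "\<iota> ` carrier G" and ?j = "inv_into (carrier G) \<iota>"
  have hom: "homeomorphic_map T (top_of_set ?K) \<iota>"
    using emb by (simp add: smooth_embedding_def embedding_map_def top)
  then have cont: "continuous_map T (top_of_set ?K) \<iota>" and inj: "inj_on \<iota> (carrier G)"
    by (auto simp: homeomorphic_eq_everything_map top)
  obtain g where g: "homeomorphic_maps T (top_of_set ?K) \<iota> g"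
    using hom by (auto simp: homeomorphic_map_maps)
  have gj: "g u = ?j u" if "u \<in> ?K" for u
    using that g inj by (auto simp: homeomorphic_maps_def top)
  have j: "continuous_map (top_of_set ?K) T ?j"
  proof (rule continuous_map_eq)
    show "continuous_map (top_of_set ?K) T g" using g by (simp add: homeomorphic_maps_def)
  qed (use gj in simp)
  have "continuous_map (prod_topology (top_of_set ?K) (top_of_set ?K)) (prod_topology T T)
      (\<lambda>p. (?j (fst p), ?j (snd p)))"
    by (intro continuous_map_pairedI continuous_map_compose[OF _ j, unfolded o_def]
        continuous_map_fst continuous_map_snd)
  from continuous_map_compose[OF continuous_map_compose[OF this mult] cont]
  have "continuous_on (?K \<times> ?K) (\<lambda>p. \<iota> (?j (fst p) \<otimes>\<^bsub>G\<^esub> ?j (snd p)))"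
    by (auto simp: o_def prod_topology_subtopology_eu)
  moreover have "compact ?K"
    using image_compactin[OF _ cont, of "carrier G"] \<open>compact_space T\<close>
    by (simp add: compactin_subtopology compact_space_def top)
  ultimately show ?thesis using inj sph by unfold_locales auto
qed

text \<open>The order of choices matters: \<epsilon> fixes \<open>F\<close> and \<open>R\<close>,
  these fix the finite sets \<open>B\<close> and \<open>D\<close>, freeness of the translation
  action gives \<delta>, and only then is the radius \<open>t\<close> taken large.\<close>

lemma (in warped_group) amenable_if_property_A:
  assumes A: "property_A W" and fin: "finite S" and H: "subgroup H G" "S \<subseteq> H" "generate G S = H"
  shows "amenable_group (G\<lparr>carrier := H\<rparr>)"
proof (rule amenable_group_approx[OF H(1) is_group H(2,3)])
  fix \<epsilon> :: real assume "0 < \<epsilon>"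
  then have "0 < \<epsilon> / 2" by simp
  \<comment> \<open>Generators move points by at most 1, and property A asks for a strict bound, so
    scale 2 is enough.\<close>
  from property_A_obtain[OF A this, of 2, unfolded mspace_W mtopology_W] obtain F r where
    F: "continuous_map (top_of_set X) (weak_star_topology (top_of_set X)) F"
    and supp: "\<And>x. x \<in> X \<Longrightarrow> AE z in F x. z \<in> X \<and> mdist W x z < r"
    and near: "\<And>x y. \<lbrakk>x \<in> X; y \<in> X; mdist W x y < 2\<rbrakk> \<Longrightarrow> norm_dist (top_of_set X) (F x) (F y) \<le> \<epsilon> / 2"
    by auto
  obtain R :: nat where R: "r \<le> R" using real_arch_simple by blast
  have HG: "H \<subseteq> carrier G" using H(1) by (rule subgroup.subset)
  \<comment> \<open>Inverses, because the bump of \<open>c\<close> is centred at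
    \<open>inv c \<otimes> g\<close>.\<close>
  define B where "B = (\<lambda>b. inv b) ` word_ball S R"
  \<comment> \<open>The bumps must stay disjoint after one generator or its inverse has shifted the
    labels.\<close>
  define D where "D = B \<union> (\<Union>s\<in>S. (\<lambda>b. s \<otimes> b) ` B \<union> (\<lambda>b. inv s \<otimes> b) ` B)"
  have wbH: "word_ball S R \<subseteq> H" using word_ball_subgroup[OF H(1,2)] .
  have BH: "B \<subseteq> H" using wbH H(1) by (auto simp: B_def subgroup.m_inv_closed)
  have DH: "D \<subseteq> H" using BH H(1,2)
    by (auto simp: D_def subset_iff intro: subgroup.m_closed subgroup.m_inv_closed)
  have DG: "D \<subseteq> carrier G" using DH HG by blast
  have finD: "finite D" using fin finite_word_ball[OF fin] by (auto simp: D_def B_def)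
  \<comment> \<open>The 1 keeps \<open>Min Q\<close> defined when \<open>D\<close> has no two
    distinct elements.\<close>
  define Q where "Q = insert 1 ((\<lambda>(a, b). \<rho> (inv a) (inv b)) ` {(a, b). a \<in> D \<and> b \<in> D \<and> a \<noteq> b})"
  have "finite {(a, b). a \<in> D \<and> b \<in> D \<and> a \<noteq> b}"
    by (rule finite_subset[of _ "D \<times> D"]) (use finD in auto)
  then have Q: "finite Q" by (simp add: Q_def)
  have "0 < q" if "q \<in> Q" for q
  proof -
    have "0 < \<rho> (inv a) (inv b)" if "a \<in> D" "b \<in> D" "a \<noteq> b" for a b
      using that DG by (intro \<rho>_pos) (auto dest: inv_inj[THEN inj_onD])
    then show ?thesis using that by (auto simp: Q_def)
  qed
  then have Qpos: "0 < Min Q" using Q by (subst Min_gr_iff) (auto simp: Q_def)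
  define \<delta> where "\<delta> = Min Q / 4"
  have \<delta>: "0 < \<delta>" using Qpos by (simp add: \<delta>_def)
  have sep: "4 * \<delta> \<le> \<rho> (inv a) (inv b)" if "a \<in> D" "b \<in> D" "a \<noteq> b" for a b
  proof -
    have "\<rho> (inv a) (inv b) \<in> Q"
      unfolding Q_def using that by (intro insertI2 image_eqI[of _ _ "(a, b)"]) auto
    from Min_le[OF Q this] show ?thesis by (simp add: \<delta>_def)
  qed
  obtain t0 where t0: "\<And>t g h t'. \<lbrakk>t0 \<le> t; g \<in> carrier G; h \<in> carrier G; 0 \<le> t';
      mdist W (t *\<^sub>R \<iota> g) (t' *\<^sub>R \<iota> h) < R\<rbrakk> \<Longrightarrow> \<exists>b\<in>word_ball S R. \<rho> h (b \<otimes> g) \<le> \<delta>"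
    using warped_ball_concentrated[OF \<delta>, of R] by metis
  define t where "t = max t0 (R + 2)"
  have t: "t0 \<le> t" "R + 2 \<le> t" "0 \<le> t" by (auto simp: t_def)
  interpret win: warped_window G \<iota> S W R t \<delta> D
    using finD DG \<delta> t sep by unfold_locales auto
  have "\<exists>\<mu> :: 'g set \<Rightarrow> real. \<mu> H = 1 \<and> (\<forall>A\<subseteq>H. 0 \<le> \<mu> A) \<and>
    (\<forall>A\<subseteq>H. \<forall>A'\<subseteq>H. A \<inter> A' = {} \<longrightarrow> \<mu> (A \<union> A') = \<mu> A + \<mu> A') \<and>
    (\<forall>s\<in>S. \<forall>A\<subseteq>H. \<bar>\<mu> (s <# A) - \<mu> A\<bar> \<le> 2 * (\<epsilon> / 2))"
  proof (rule win.almost_invariant_mean[OF F, where B = B])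
    show "norm_dist (top_of_set X) (F (t *\<^sub>R \<iota> g)) (F (t *\<^sub>R \<iota> (s \<otimes> g))) \<le> \<epsilon> / 2"
      if "s \<in> S" "g \<in> carrier G" for s g
      using W_generator[OF that(1) t(3) that(2)] that S t(3) by (intro near cone_point) auto
    show "s \<otimes> b \<in> D \<and> inv s \<otimes> b \<in> D" if "s \<in> S" "b \<in> B" for s b
      using that by (auto simp: D_def)
    fix g assume g: "g \<in> carrier G"
    show "AE z in F (t *\<^sub>R \<iota> g). z \<in> X \<and>
      (\<exists>s h b. 0 \<le> s \<and> \<bar>s - t\<bar> \<le> R \<and> h \<in> carrier G \<and> z = s *\<^sub>R \<iota> h \<and> b \<in> B \<and> \<rho> h (inv b \<otimes> g) \<le> \<delta>)"
      using supp[OF cone_point[OF t(3) g]]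
    proof eventually_elim
      case (elim z)
      then obtain s h where z: "0 \<le> s" "h \<in> carrier G" "z = s *\<^sub>R \<iota> h" by (blast elim: cone_pointE)
      have less: "mdist W (t *\<^sub>R \<iota> g) (s *\<^sub>R \<iota> h) < R" using elim z(3) R by simp
      obtain b where b: "b \<in> word_ball S R" "\<rho> h (b \<otimes> g) \<le> \<delta>"
        using t0[OF t(1) g z(2,1) less] by blast
      have "\<bar>norm (t *\<^sub>R \<iota> g) - norm (s *\<^sub>R \<iota> h)\<bar> \<le> mdist W (t *\<^sub>R \<iota> g) (s *\<^sub>R \<iota> h)"
        using z(1,2) g t(3) by (intro W_norm cone_point)
      then have "\<bar>s - t\<bar> \<le> R" using less z(1,2) g t(3) by simp
      moreover have "inv b \<in> B" "inv (inv b) = b" using b(1) wbH HG by (auto simp: B_def)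
      ultimately show ?case using elim z b(2) by metis
    qed
  qed (use BH HG \<open>0 < \<epsilon>\<close> in \<open>auto simp: D_def\<close>)
  then show "\<exists>\<mu> :: 'g set \<Rightarrow> real. \<mu> H = 1 \<and> (\<forall>A\<subseteq>H. 0 \<le> \<mu> A) \<and>
    (\<forall>A\<subseteq>H. \<forall>A'\<subseteq>H. A \<inter> A' = {} \<longrightarrow> \<mu> (A \<union> A') = \<mu> A + \<mu> A') \<and>
    (\<forall>s\<in>S. \<forall>A\<subseteq>H. \<bar>\<mu> (s <# A) - \<mu> A\<bar> \<le> \<epsilon>)" by simp
qed

theorem proposition4p1:
  fixes G :: "('g, 'm) monoid_scheme"
    and T :: "'g topology"
    and V :: "'e::euclidean_space set"
    and \<A> :: "('g, 'e) atlas"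
    and \<Gamma> S :: "'g set"
    and \<iota> :: "'g \<Rightarrow> 'a::euclidean_space"
    and W :: "'a metric"
  assumes "Lie_group V G T \<A>" and "compact_space T"
    and "subgroup \<Gamma> G" and "T closure_of \<Gamma> = carrier G"
    and "finite S" and "S \<subseteq> \<Gamma>" and "generate G S = \<Gamma>"
    and "smooth_embedding V T \<A> \<iota>" and "\<iota> ` carrier G \<subseteq> sphere 0 1"
    and "is_warped_metric (submetric euclidean_metric (open_cone (\<iota> ` carrier G)))
           (cone_action (carrier G) \<iota> (\<lambda>\<gamma> y. \<gamma> \<otimes>\<^bsub>G\<^esub> y)) S W"
    and "property_A W"
  shows "amenable_group (G\<lparr>carrier := \<Gamma>\<rparr>)"
proof -
  interpret group G using assms(1) by (simp add: Lie_group_def)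
  have \<Gamma>: "\<Gamma> \<subseteq> carrier G" using assms(3) by (rule subgroup.subset)
  interpret warped_group G \<iota> S W
    using embedded_group_of_Lie_group[OF assms(1,2,8,9)] assms(6,10) \<Gamma>
    by (intro warped_group.intro warped_group_axioms.intro) auto
  show ?thesis using amenable_if_property_A[OF assms(11,5,3,6,7)] .
qed

end
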